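(* Let $\mathcal{X}=\mathbb{F}_q$ with $q$ prime, let $W:\mathcal{X}\to\mathcal{Y}$ be a discrete memoryless channel, and let $G$ be an $\ell\times\ell$ full-rank lower triangular matrix over $\mathcal{X}$ which is not diagonal. Let the kernel be the linear map $g(u_0^{\ell-1})=u_0^{\ell-1}G$. Let $I_\infty$ be the almost sure limit of $I(W^{(B_1)\cdots(B_n)})$ as $n\to\infty$. Then $P(I_\infty\in\{0,1\})=1$.
   Context: Notation: $u_i^j=(u_i,\dots,u_j)$ denotes a row vector. A discrete memoryless channel (DMC) $W:\mathcal{X}\to\mathcal{Y}$ with finite input alphabet $\mathcal{X}$, $|\mathcal{X}|=q$, and at most countable output alphabet $\mathcal{Y}$ is a family of probability distributions $W(\cdot\mid x)$ on $\mathcal{Y}$, $x\in\mathcal{X}$. Its symmetric capacity, with logarithm to base $q$, is $$I(W)=\sum_{x\in\mathcal{X}}\sum_{y\in\mathcal{Y}}\frac1q W(y\mid x)\log_q\frac{W(y\mid x)}{\frac1q\sum_{x'\in\mathcal{X}}W(y\mid x')}\in[0,1].$$ Channel transform: given a bijection $g:\mathcal{X}^\ell\to\mathcal{X}^\ell$ (the kernel), set $W^\ell(y_0^{\ell-1}\mid x_0^{\ell-1})=\prod_{i=0}^{\ell-1}W(y_i\mid x_i)$, and for $i\in\{0,\dots,\ell-1\}$ define the DMC $W^{(i)}:\mathcal{X}\to\mathcal{Y}^\ell\times\mathcal{X}^{i}$ by $$W^{(i)}(y_0^{\ell-1},u_0^{i-1}\mid u_i)=\frac1{q^{\ell-1}}\sum_{u_{i+1}^{\ell-1}\in\mathcal{X}^{\ell-1-i}}W^\ell(y_0^{\ell-1}\mid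 g(u_0^{\ell-1})).$$ Iterating, $W^{(b_1)\cdots(b_n)}=(W^{(b_1)\cdots(b_{n-1})})^{(b_n)}$. The sequence $B_1,B_2,\dots$ consists of independent random variables uniform on $\{0,\dots,\ell-1\}$. The sequence $I(W^{(B_1)\cdots(B_n)})$ converges almost surely to a random variable, denoted $I_\infty$. *)

theory Defs
  imports "HOL-Probability.Probability" "Jordan_Normal_Form.DL_Rank"
begin

text \<open>A discrete memoryless channel is a function \<open>W :: 'x \<Rightarrow> 'o pmf\<close>, with
  \<open>W(y | x) = pmf (W x) y\<close>. Tuples over the input and output alphabets are lists.\<close>

text \<open>Terms with \<open>W(y | x) = 0\<close> vanish because of the factor in front of the logarithm. The sum over
  \<open>y\<close> converges absolutely.\<close>

definition sym_capacity :: "('x::finite \<Rightarrow> 'o pmf) \<Rightarrow> real" where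
  "sym_capacity W =
    (\<Sum>x\<in>UNIV. \<Sum>\<^sub>\<infinity>y. 1 / real CARD('x) * pmf (W x) y *
       log (real CARD('x))
         (pmf (W x) y / (1 / real CARD('x) * (\<Sum>x'\<in>UNIV. pmf (W x') y))))"

definition power_prob :: "nat \<Rightarrow> ('x \<Rightarrow> 'o pmf) \<Rightarrow> 'o list \<Rightarrow> 'x list \<Rightarrow> real" where
  "power_prob l W ys xs = (\<Prod>j<l. pmf (W (xs ! j)) (ys ! j))"

text \<open>The transition probability \<open>W\<^sup>(\<^sup>i\<^sup>)(ys, us | u)\<close>, extended by zero outside the output alphabet
  of pairs of an \<open>l\<close>-tuple and an \<open>i\<close>-tuple.\<close>

definition split_prob ::
  "nat \<Rightarrow> ('x::finite list \<Rightarrow> 'x list) \<Rightarrow> ('x \<Rightarrow> 'o pmf) \<Rightarrow> nat \<Rightarrow> 'x \<Rightarrow> 'o list \<times> 'x list \<Rightarrow> real" where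
  "split_prob l g W i u = (\<lambda>(ys, us).
     if length ys = l \<and> length us = i
     then 1 / real CARD('x) ^ (l - 1) *
       (\<Sum>vs | length vs = l - 1 - i. power_prob l W ys (g (us @ [u] @ vs)))
     else 0)"

text \<open>For \<open>i < l\<close> and \<open>g\<close> mapping \<open>l\<close>-tuples to \<open>l\<close>-tuples, \<open>embed_pmf\<close> is applied to a probability
  mass function; see \<open>pmf_split_channel\<close> below.\<close>

definition split_channel ::
  "nat \<Rightarrow> ('x::finite list \<Rightarrow> 'x list) \<Rightarrow> ('x \<Rightarrow> 'o pmf) \<Rightarrow> nat \<Rightarrow> 'x \<Rightarrow> ('o list \<times> 'x list) pmf" where
  "split_channel l g W i u = embed_pmf (split_prob l g W i u)"

text \<open>Each application of the transform changes the output alphabet from \<open>\<Y>\<close> to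
  \<open>\<Y>\<^sup>l \<times> \<X>\<^sup>i\<close>. The following type contains injective copies of all the alphabets that arise when
  iterating; outputs outside the relevant copy have probability zero.\<close>

datatype ('x, 'y) out = Leaf 'y | Node "('x, 'y) out list" "'x list"

definition iterated_channel ::
  "nat \<Rightarrow> ('x::finite list \<Rightarrow> 'x list) \<Rightarrow> ('x \<Rightarrow> 'y pmf) \<Rightarrow> nat list \<Rightarrow> 'x \<Rightarrow> ('x, 'y) out pmf" where
  "iterated_channel l g W bs =
    fold (\<lambda>b V u. map_pmf (\<lambda>(ys, us). Node ys us) (split_channel l g V b u)) bs
      (\<lambda>u. map_pmf Leaf (W u))"

text \<open>The row vector \<open>u\<close> multiplied by \<open>G\<close> from the right.\<close>

definition linear_kernel :: "'a::comm_ring_1 mat \<Rightarrow> 'a list \<Rightarrow> 'a list" where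
  "linear_kernel G u = map (\<lambda>j. \<Sum>i<dim_row G. u ! i * G $$ (i, j)) [0..<dim_col G]"

definition lower_triangular :: "'a::zero mat \<Rightarrow> bool" where
  "lower_triangular A \<longleftrightarrow> (\<forall>i<dim_row A. \<forall>j<dim_col A. i < j \<longrightarrow> A $$ (i, j) = 0)"

text \<open>Auxiliary: the product distribution as a pmf, used only to show that \<open>split_prob\<close> is a
  probability mass function.\<close>

primrec power_pmf :: "('x \<Rightarrow> 'o pmf) \<Rightarrow> 'x list \<Rightarrow> 'o list pmf" where
  "power_pmf W [] = return_pmf []"
| "power_pmf W (x # xs) = map_pmf (\<lambda>(y, ys). y # ys) (pair_pmf (W x) (power_pmf W xs))"

lemma pmf_power_pmf:
  fixes W :: "'x \<Rightarrow> 'o pmf"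
  shows "pmf (power_pmf W xs) ys = (if length ys = length xs then power_prob (length xs) W ys xs else 0)"
proof (induction xs arbitrary: ys)
  case Nil
  then show ?case by (auto simp: power_prob_def indicator_def)
next
  case (Cons x xs)
  show ?case
  proof (cases ys)
    case Nil
    then show ?thesis by (auto simp: pmf_eq_0_set_pmf)
  next
    case (Cons z zs)
    have "inj (\<lambda>(y::'o, ys). y # ys)" by (auto simp: inj_def)
    from pmf_map_inj'[OF this, of "pair_pmf (W x) (power_pmf W xs)" "(z, zs)"]
    have "pmf (power_pmf W (x # xs)) (z # zs) = pmf (W x) z * pmf (power_pmf W xs) zs"
      by (simp add: pmf_pair)
    then show ?thesis
      by (simp add: Cons Cons.IH power_prob_def prod.lessThan_Suc_shift del: prod.lessThan_Suc)
  qed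
qed

lemma pmf_split_channel:
  fixes g :: "'x::finite list \<Rightarrow> 'x list" and W :: "'x \<Rightarrow> 'o pmf"
  assumes i: "i < l" and g: "\<And>xs. length xs = l \<Longrightarrow> length (g xs) = l"
  shows "pmf (split_channel l g W i u) z = split_prob l g W i u z"
proof -
  let ?q = "real CARD('x)"
  have card: "card {vs :: 'x list. length vs = n} = CARD('x) ^ n"
    and fin: "finite {vs :: 'x list. length vs = n}" for n
    using card_lists_length_eq[of "UNIV :: 'x set" n] finite_lists_length_eq[of "UNIV :: 'x set" n]
    by simp_all
  have nonneg: "0 \<le> split_prob l g W i u z" for z
    by (auto simp: split_prob_def power_prob_def split: prod.split
        intro!: divide_nonneg_nonneg sum_nonneg prod_nonneg)
  have inner: "(\<integral>\<^sup>+ ys. ennreal (split_prob l g W i u (ys, us)) \<partial>count_space UNIV)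
      = ennreal (1 / ?q ^ i) * indicator {us. length us = i} us" for us
  proof (cases "length us = i")
    case True
    let ?V = "{vs :: 'x list. length vs = l - 1 - i}"
    have len: "length (g (us @ [u] @ vs)) = l" if "vs \<in> ?V" for vs
      using that True i by (intro g) auto
    have "split_prob l g W i u (ys, us)
        = (\<Sum>vs\<in>?V. 1 / ?q ^ (l - 1) * pmf (power_pmf W (g (us @ [u] @ vs))) ys)" for ys
      using len by (simp add: split_prob_def pmf_power_pmf True sum_distrib_left)
    then have "(\<integral>\<^sup>+ ys. ennreal (split_prob l g W i u (ys, us)) \<partial>count_space UNIV)
        = (\<integral>\<^sup>+ ys. (\<Sum>vs\<in>?V. ennreal (1 / ?q ^ (l - 1)) *
             ennreal (pmf (power_pmf W (g (us @ [u] @ vs))) ys)) \<partial>count_space UNIV)"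
      by (simp add: ennreal_mult'[symmetric] sum_ennreal)
    also have "\<dots> = (\<Sum>vs\<in>?V. ennreal (1 / ?q ^ (l - 1)) *
        (\<integral>\<^sup>+ ys. ennreal (pmf (power_pmf W (g (us @ [u] @ vs))) ys) \<partial>count_space UNIV))"
      by (simp add: nn_integral_sum nn_integral_cmult)
    also have "\<dots> = (\<Sum>vs\<in>?V. ennreal (1 / ?q ^ (l - 1)))"
      by (simp add: nn_integral_pmf emeasure_pmf)
    also have "\<dots> = ennreal (?q ^ (l - 1 - i) * (1 / ?q ^ (l - 1)))"
      by (subst sum_ennreal) (simp_all add: card)
    also have "?q ^ (l - 1 - i) * (1 / ?q ^ (l - 1)) = 1 / ?q ^ i"
      using i by (simp add: field_simps flip: power_add)
    finally show ?thesis using True by simp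
  next
    case False
    then show ?thesis by (simp add: split_prob_def)
  qed
  have "(\<integral>\<^sup>+ z. ennreal (split_prob l g W i u z) \<partial>count_space UNIV)
      = (\<integral>\<^sup>+ us. (\<integral>\<^sup>+ ys. ennreal (split_prob l g W i u (ys, us)) \<partial>count_space UNIV) \<partial>count_space UNIV)"
    using nn_integral_snd_count_space[of "\<lambda>z. ennreal (split_prob l g W i u z)"] by simp
  also have "\<dots> = ennreal (1 / ?q ^ i) * of_nat (card {us :: 'x list. length us = i})"
    unfolding inner by (simp add: nn_integral_cmult_indicator fin)
  also have "\<dots> = ennreal (1 / ?q ^ i * real (CARD('x) ^ i))"
    by (simp only: card ennreal_of_nat_eq_real_of_nat) (simp add: ennreal_mult'[symmetric])
  also have "\<dots> = 1" by simp
  finally show ?thesis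
    unfolding split_channel_def by (intro pmf_embed_pmf nonneg)
qed

end

theory Submission
  imports Defs "HOL-Number_Theory.Residues"
begin

text \<open>Let \<open>k\<close> be the last row of \<open>G\<close> with an off-diagonal entry, in column \<open>j\<close> say. The split channel
  \<open>W\<^sup>(\<^sup>k\<^sup>)\<close> can be degraded to \<open>u \<mapsto> (Y, Y', c)\<close> with \<open>c\<close> uniform, \<open>Y\<close> the output of \<open>W\<close> at \<open>u G\<^sub>k\<^sub>k\<close> and \<open>Y'\<close>
  the output of \<open>W\<close> at \<open>c + u G\<^sub>k\<^sub>j\<close>. Its capacity exceeds \<open>I(W)\<close> by the expectation of the Jensen gap
  \<open>H(X' - b X) - H(X')\<close>, where \<open>b = G\<^sub>k\<^sub>j\<close> and \<open>X\<close>, \<open>X'\<close> are independent with the posterior distributions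
  given \<open>Y\<close>, \<open>Y'\<close>. As \<open>q\<close> is prime, this gap vanishes only if \<open>X\<close> is deterministic or \<open>X'\<close> uniform, so by
  compactness of the simplex the gain is bounded below by some \<open>\<eta>(\<delta>) > 0\<close> whenever
  \<open>\<delta> \<le> I(W) \<le> 1 - \<delta>\<close>, uniformly over all channels and output alphabets. Almost surely \<open>B\<^sub>n = k\<close> for
  infinitely many \<open>n\<close>, hence the capacities cannot converge to a limit strictly between 0 and 1.\<close>

subsection \<open>Symmetric capacity and posterior distributions\<close>

text \<open>The output law under uniform input. The same definition later averages over the uniform
  side information in \<open>combined_channel\<close>.\<close>

definition out_pmf :: "('x::finite \<Rightarrow> 'o pmf) \<Rightarrow> 'o pmf" where
  "out_pmf W = bind_pmf (pmf_of_set UNIV) W"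

text \<open>Off the support of \<open>out_pmf W\<close> the denominator is 0, so division by zero
  makes this the zero vector there and not a distribution.\<close>

definition posterior :: "('x::finite \<Rightarrow> 'o pmf) \<Rightarrow> 'o \<Rightarrow> 'x \<Rightarrow> real" where
  "posterior W y x = pmf (W x) y / (\<Sum>x'\<in>UNIV. pmf (W x') y)"

definition xlogx :: "real \<Rightarrow> real \<Rightarrow> real" where
  "xlogx b t = t * log b t"

text \<open>For a distribution this is 1 minus the entropy in base q, that is, the divergence from
  uniform: 0 at the uniform distribution, 1 at a point mass.\<close>

definition redundancy :: "('x::finite \<Rightarrow> real) \<Rightarrow> real" where
  "redundancy p = 1 + (\<Sum>x\<in>UNIV. xlogx (real CARD('x)) (p x))"

lemma xlogx_0 [simp]: "xlogx b 0 = 0" and xlogx_1 [simp]: "xlogx b 1 = 0"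
  by (simp_all add: xlogx_def)

lemma xlogx_nonpos: "1 < b \<Longrightarrow> 0 \<le> t \<Longrightarrow> t \<le> 1 \<Longrightarrow> xlogx b t \<le> 0"
  unfolding xlogx_def by (cases "t = 0") (auto simp: mult_le_0_iff)

text \<open>The inequality \<open>ln s \<le> s - 1\<close> at \<open>s = 1 / t\<close>. This crude
  bound makes the integrands below bounded, hence integrable.\<close>

lemma xlogx_lower:
  assumes "1 < b" "0 \<le> t"
  shows "- 1 / ln b \<le> xlogx b t"
proof (cases "t = 0")
  case False
  with assms have t: "t > 0" by simp
  have "ln (1 / t) \<le> 1 / t - 1" using t by (intro ln_le_minus_one) auto
  hence "t * ln (1 / t) \<le> t * (1 / t - 1)" using t by (intro mult_left_mono) auto
  hence "- 1 \<le> t * ln t" using t by (simp add: ln_div algebra_simps)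
  hence "- 1 / ln b \<le> t * ln t / ln b" using assms by (intro divide_right_mono) auto
  thus ?thesis by (simp add: xlogx_def log_def)
qed (use assms in auto)

lemma xlogx_mult:
  assumes "1 < b" "0 \<le> s" "0 \<le> t"
  shows "xlogx b (s * t) = s * xlogx b t + t * xlogx b s"
  using assms by (cases "s = 0 \<or> t = 0") (auto simp: xlogx_def log_mult algebra_simps)

lemma pmf_out_pmf: "pmf (out_pmf W) y = (\<Sum>x\<in>UNIV. pmf (W x) y) / real CARD('x)"
  for W :: "'x::finite \<Rightarrow> 'o pmf"
  unfolding out_pmf_def by (simp add: pmf_bind integral_pmf_of_set)

text \<open>If \<open>y\<close> has output probability 0, then every \<open>pmf (W x) y\<close> is 0
  too, so the identity survives the division by zero in \<open>posterior\<close>.\<close>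

lemma pmf_conv_posterior: "pmf (W x) y = real CARD('x) * (pmf (out_pmf W) y * posterior W y x)"
  for W :: "'x::finite \<Rightarrow> 'o pmf"
  using sum_nonneg_eq_0_iff[of UNIV "\<lambda>x. pmf (W x) y"]
  by (auto simp: pmf_out_pmf posterior_def)

lemma posterior_nonneg: "0 \<le> posterior W y x"
  by (auto simp: posterior_def intro!: divide_nonneg_nonneg sum_nonneg)

lemma posterior_le_1: "posterior W y x \<le> 1"
proof -
  have "pmf (W x) y \<le> (\<Sum>x'\<in>UNIV. pmf (W x') y)"
    by (rule member_le_sum) auto
  thus ?thesis unfolding posterior_def
    by (intro divide_le_eq_1[THEN iffD2]) (smt (verit) pmf_nonneg)
qed

lemma sum_posterior:
  assumes "y \<in> set_pmf (out_pmf W)"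
  shows "(\<Sum>x\<in>UNIV. posterior W y x) = 1"
proof -
  have "(\<Sum>x\<in>UNIV. pmf (W x) y) \<noteq> 0"
    using assms by (auto simp: set_pmf_iff pmf_out_pmf)
  thus ?thesis by (simp add: posterior_def sum_divide_distrib[symmetric])
qed

section \<open>Capacity as an expectation under the output law\<close>

text \<open>By \<open>pmf_conv_posterior\<close>, the law \<open>W x\<close> has density q times the
  posterior with respect to the output law.\<close>

lemma integral_channel:
  fixes W :: "'x::finite \<Rightarrow> 'o pmf" and k :: "'o \<Rightarrow> real"
  shows "measure_pmf.expectation (W x) k
    = real CARD('x) * measure_pmf.expectation (out_pmf W) (\<lambda>y. posterior W y x * k y)"
proof -
  have "measure_pmf.expectation (W x) k = (LINT y|count_space UNIV. pmf (W x) y * k y)"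
    unfolding measure_pmf_eq_density by (simp add: integral_density)
  also have "\<dots> = (LINT y|count_space UNIV. real CARD('x) * (pmf (out_pmf W) y * (posterior W y x * k y)))"
    by (simp only: pmf_conv_posterior[of W x] mult.assoc)
  also have "\<dots> = real CARD('x) * measure_pmf.expectation (out_pmf W) (\<lambda>y. posterior W y x * k y)"
    unfolding measure_pmf_eq_density by (simp add: integral_density)
  finally show ?thesis .
qed

lemma integrable_channel:
  fixes W :: "'x::finite \<Rightarrow> 'o pmf" and k :: "'o \<Rightarrow> real"
  shows "integrable (W x) k \<longleftrightarrow> integrable (out_pmf W) (\<lambda>y. posterior W y x * k y)"
proof -
  have "integrable (W x) k \<longleftrightarrow> integrable (count_space UNIV) (\<lambda>y. pmf (W x) y * k y)"
    unfolding measure_pmf_eq_density by (simp add: integrable_density)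
  also have "\<dots> \<longleftrightarrow> integrable (count_space UNIV)
      (\<lambda>y. real CARD('x) * (pmf (out_pmf W) y * (posterior W y x * k y)))"
    by (simp only: pmf_conv_posterior[of W x] mult.assoc)
  also have "\<dots> \<longleftrightarrow> integrable (out_pmf W) (\<lambda>y. posterior W y x * k y)"
    unfolding measure_pmf_eq_density by (simp add: integrable_density)
  finally show ?thesis .
qed

lemma bounded_integrable_pmf:
  fixes k :: "'o \<Rightarrow> real"
  assumes "\<And>y. y \<in> set_pmf p \<Longrightarrow> \<bar>k y\<bar> \<le> c"
  shows "integrable (measure_pmf p) k"
  by (rule measure_pmf.integrable_const_bound[where B = c]) (use assms in \<open>auto simp: AE_measure_pmf_iff\<close>)

lemma posterior_log_abs:
  assumes "1 < b" "0 \<le> t" "t \<le> 1"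
  shows "\<bar>t * log b (b * t)\<bar> \<le> 1 + 1 / ln b"
proof -
  have "t * log b (b * t) = t + xlogx b t"
    using assms by (cases "t = 0") (auto simp: xlogx_def log_mult algebra_simps)
  moreover have "1 / ln b \<ge> 0" using assms by simp
  ultimately show ?thesis using xlogx_nonpos[OF assms] xlogx_lower[OF assms(1,2)] assms by auto
qed

text \<open>Links the unordered sum in \<open>sym_capacity\<close> to an integral: integrability
  under \<open>p\<close> is absolute summability of the weighted terms.\<close>

lemma infsum_pmf_mult:
  fixes k :: "'o \<Rightarrow> real"
  assumes "integrable (measure_pmf p) k"
  shows "(\<Sum>\<^sub>\<infinity>y. pmf p y * k y) = measure_pmf.expectation p k"
proof -
  have "Infinite_Set_Sum.abs_summable_on (\<lambda>y. pmf p y * k y) UNIV"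
    using assms unfolding abs_summable_on_def measure_pmf_eq_density
    by (simp add: integrable_density)
  from infsetsum_infsum[OF this]
  show ?thesis
    unfolding infsetsum_def measure_pmf_eq_density by (simp add: integral_density)
qed

lemma sum_posterior_log:
  fixes W :: "'x::finite \<Rightarrow> 'o pmf"
  assumes "1 < CARD('x)" "y \<in> set_pmf (out_pmf W)"
  shows "(\<Sum>x\<in>UNIV. posterior W y x * log CARD('x) (CARD('x) * posterior W y x)) = redundancy (posterior W y)"
proof -
  have "posterior W y x * log CARD('x) (CARD('x) * posterior W y x) = posterior W y x + xlogx CARD('x) (posterior W y x)" for x
    using assms(1) posterior_nonneg[of W y x]
    by (cases "posterior W y x = 0") (auto simp: xlogx_def log_mult algebra_simps)
  thus ?thesis using sum_posterior[OF assms(2)] by (simp add: redundancy_def sum.distrib)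
qed

lemma integrable_posterior_log:
  fixes W :: "'x::finite \<Rightarrow> 'o pmf"
  assumes "1 < CARD('x)"
  shows "integrable (measure_pmf (out_pmf W)) (\<lambda>y. posterior W y x * log CARD('x) (CARD('x) * posterior W y x))"
  using assms
  by (intro bounded_integrable_pmf[where c = "1 + 1 / ln CARD('x)"] posterior_log_abs)
     (auto simp: posterior_nonneg posterior_le_1)

lemma sym_capacity_eq_sum:
  fixes W :: "'x::finite \<Rightarrow> 'o pmf"
  assumes "1 < CARD('x)"
  shows "sym_capacity W = (\<Sum>x\<in>UNIV. measure_pmf.expectation (out_pmf W)
    (\<lambda>y. posterior W y x * log CARD('x) (CARD('x) * posterior W y x)))"
proof -
  let ?q = "real CARD('x)"
  have "1 / ?q * pmf (W x) y * log ?q (pmf (W x) y / (1 / ?q * (\<Sum>x'\<in>UNIV. pmf (W x') y)))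
      = pmf (out_pmf W) y * (posterior W y x * log ?q (?q * posterior W y x))" for x y
  proof -
    have "pmf (W x) y / (1 / ?q * (\<Sum>x'\<in>UNIV. pmf (W x') y)) = ?q * posterior W y x"
      by (simp add: posterior_def)
    moreover have "1 / ?q * pmf (W x) y = pmf (out_pmf W) y * posterior W y x"
      by (subst pmf_conv_posterior) simp
    ultimately show ?thesis by (simp only: mult.assoc)
  qed
  then show ?thesis
    unfolding sym_capacity_def
    by (simp only: infsum_pmf_mult[OF integrable_posterior_log[OF assms]])
qed

text \<open>Capacity is 1 minus the conditional entropy of the input given the output. The gain
  estimates see a channel only through its posteriors, which makes them uniform over output
  alphabets.\<close>

lemma sym_capacity_eq_expectation:
  fixes W :: "'x::finite \<Rightarrow> 'o pmf"
  assumes "1 < CARD('x)"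
  shows "sym_capacity W = measure_pmf.expectation (out_pmf W) (\<lambda>y. redundancy (posterior W y))"
proof -
  have "sym_capacity W = measure_pmf.expectation (out_pmf W)
      (\<lambda>y. \<Sum>x\<in>UNIV. posterior W y x * log CARD('x) (CARD('x) * posterior W y x))"
    by (simp add: sym_capacity_eq_sum[OF assms] integrable_posterior_log[OF assms])
  also have "\<dots> = measure_pmf.expectation (out_pmf W) (\<lambda>y. redundancy (posterior W y))"
    by (intro integral_cong_AE) (use assms in \<open>auto simp: AE_measure_pmf_iff sum_posterior_log\<close>)
  finally show ?thesis .
qed

text \<open>Posteriors sum to 1 on the support, so summing the change of measure over the inputs
  recovers the plain expectation.\<close>

lemma expectation_out_pmf:
  fixes W :: "'x::finite \<Rightarrow> 'o pmf" and k :: "'o \<Rightarrow> real"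
  assumes "\<And>y. \<bar>k y\<bar> \<le> c"
  shows "measure_pmf.expectation (out_pmf W) k
    = (\<Sum>x\<in>UNIV. measure_pmf.expectation (W x) k) / real CARD('x)"
proof -
  have "integrable (measure_pmf (out_pmf W)) (\<lambda>y. posterior W y x * k y)" for x
    using mult_mono[OF posterior_le_1 assms]
    by (intro bounded_integrable_pmf[where c = "1 * c"]) (simp add: abs_mult abs_of_nonneg[OF posterior_nonneg])
  then have "(\<Sum>x\<in>UNIV. measure_pmf.expectation (W x) k)
      = real CARD('x) * measure_pmf.expectation (out_pmf W) (\<lambda>y. \<Sum>x\<in>UNIV. posterior W y x * k y)"
    unfolding integral_channel[of W] by (simp add: sum_distrib_left)
  also have "measure_pmf.expectation (out_pmf W) (\<lambda>y. \<Sum>x\<in>UNIV. posterior W y x * k y)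
      = measure_pmf.expectation (out_pmf W) k"
    by (intro integral_cong_AE) (auto simp: AE_measure_pmf_iff sum_posterior simp flip: sum_distrib_right)
  finally show ?thesis by simp
qed

section \<open>Convexity of t log t and the data processing inequality\<close>

text \<open>The slope is the derivative at \<open>r\<close>. The claim reduces to
  \<open>ln s \<le> s - 1\<close> at \<open>s = r / t\<close>, which is strict unless
  \<open>s = 1\<close>.\<close>

lemma xlogx_tangent:
  assumes "1 < b" "0 \<le> t" "0 < r"
  shows "xlogx b r + (t - r) * (log b r + 1 / ln b) \<le> xlogx b t"
    and "t \<noteq> r \<Longrightarrow> xlogx b r + (t - r) * (log b r + 1 / ln b) < xlogx b t"
proof -
  have lb: "ln b > 0" using assms by simp
  have diff: "xlogx b t - (xlogx b r + (t - r) * (log b r + 1 / ln b)) = (t * ln t - t * ln r - (t - r)) / ln b"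
    using lb by (simp add: xlogx_def log_def field_simps)
  have *: "0 \<le> t * ln t - t * ln r - (t - r) \<and> (t \<noteq> r \<longrightarrow> 0 < t * ln t - t * ln r - (t - r))"
  proof (cases "t = 0")
    case False
    with assms have t: "t > 0" by simp
    have eq: "t * ln t - t * ln r - (t - r) = t * (r / t - 1 - ln (r / t))"
      using t assms by (simp add: ln_div algebra_simps)
    have "ln (r / t) \<le> r / t - 1" using t assms by (intro ln_le_minus_one) auto
    moreover have "ln (r / t) \<noteq> r / t - 1" if "t \<noteq> r"
      using ln_eq_minus_one[of "r / t"] t assms that by auto
    ultimately show ?thesis unfolding eq using t by (auto simp: zero_less_mult_iff zero_le_mult_iff)
  qed (use assms in auto)
  show "xlogx b r + (t - r) * (log b r + 1 / ln b) \<le> xlogx b t"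
    using divide_nonneg_pos[OF conjunct1[OF *] lb] diff by linarith
  show "xlogx b r + (t - r) * (log b r + 1 / ln b) < xlogx b t" if "t \<noteq> r"
    using divide_pos_pos[OF mp[OF conjunct2[OF *] that] lb] diff by linarith
qed

text \<open>Averages the tangent at the weighted mean. A tangent exists only at a positive mean; at
  mean 0 every \<open>w x * t x\<close> vanishes.\<close>

lemma xlogx_jensen:
  fixes w t :: "'x::finite \<Rightarrow> real"
  assumes b: "1 < b" and w: "\<And>x. 0 \<le> w x" "(\<Sum>x\<in>UNIV. w x) = 1" and t: "\<And>x. 0 \<le> t x"
  shows "xlogx b (\<Sum>x\<in>UNIV. w x * t x) \<le> (\<Sum>x\<in>UNIV. w x * xlogx b (t x))"
    and "0 < w x0 \<Longrightarrow> t x0 \<noteq> (\<Sum>x\<in>UNIV. w x * t x)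
      \<Longrightarrow> xlogx b (\<Sum>x\<in>UNIV. w x * t x) < (\<Sum>x\<in>UNIV. w x * xlogx b (t x))"
proof -
  let ?r = "\<Sum>x\<in>UNIV. w x * t x"
  have r: "0 \<le> ?r" using w t by (intro sum_nonneg) auto
  have zero: "w x * t x = 0" if "?r = 0" for x
    using that w t sum_nonneg_eq_0_iff[of UNIV "\<lambda>x. w x * t x"] by auto
  let ?T = "\<lambda>x. w x * (xlogx b ?r + (t x - ?r) * (log b ?r + 1 / ln b))"
  have "(\<Sum>x\<in>UNIV. w x * (a + (t x - r) * c)) = (\<Sum>x\<in>UNIV. w x) * (a - r * c) + (\<Sum>x\<in>UNIV. w x * t x) * c"
    for a c r
    unfolding sum_distrib_right sum.distrib[symmetric] by (intro sum.cong) (auto simp: algebra_simps)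
  then have T: "(\<Sum>x\<in>UNIV. ?T x) = xlogx b ?r" by (simp add: w)
  have le: "?T x \<le> w x * xlogx b (t x)" if "0 < ?r" for x
    using xlogx_tangent(1)[OF b t that] w by (intro mult_left_mono) auto
  show "xlogx b ?r \<le> (\<Sum>x\<in>UNIV. w x * xlogx b (t x))"
  proof (cases "?r = 0")
    case True
    have "w x * xlogx b (t x) = 0" for x
      using zero[OF True, of x] by auto
    then show ?thesis using True by simp
  next
    case False
    with r have r': "0 < ?r" by simp
    have "(\<Sum>x\<in>UNIV. ?T x) \<le> (\<Sum>x\<in>UNIV. w x * xlogx b (t x))"
      by (intro sum_mono le r')
    then show ?thesis unfolding T .
  qed
  show "xlogx b ?r < (\<Sum>x\<in>UNIV. w x * xlogx b (t x))" if w0: "0 < w x0" and t0: "t x0 \<noteq> ?r"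
  proof -
    have "?r \<noteq> 0" using zero[of x0] w0 t0 by auto
    with r have r': "0 < ?r" by simp
    have "?T x0 < w x0 * xlogx b (t x0)"
      using xlogx_tangent(2)[OF b t r' t0] w0 by (intro mult_strict_left_mono) auto
    then have "(\<Sum>x\<in>UNIV. ?T x) < (\<Sum>x\<in>UNIV. w x * xlogx b (t x))"
      by (intro sum_strict_mono_ex1) (use le[OF r'] in auto)
    then show ?thesis unfolding T .
  qed
qed

lemma redundancy_le_1:
  fixes p :: "'x::finite \<Rightarrow> real"
  assumes "1 < CARD('x)" "\<And>x. 0 \<le> p x" "\<And>x. p x \<le> 1"
  shows "redundancy p \<le> 1"
  unfolding redundancy_def using assms by (auto intro!: sum_nonpos xlogx_nonpos)

text \<open>Jensen's inequality with uniform weights; the mean is 1/q, where \<open>xlogx\<close>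
  equals -1/q.\<close>

lemma redundancy_nonneg:
  fixes p :: "'x::finite \<Rightarrow> real"
  assumes q: "1 < CARD('x)" and p: "\<And>x. 0 \<le> p x" "(\<Sum>x\<in>UNIV. p x) = 1"
  shows "0 \<le> redundancy p"
proof -
  let ?q = "real CARD('x)"
  have "xlogx ?q (\<Sum>x\<in>UNIV. 1 / ?q * p x) \<le> (\<Sum>x\<in>UNIV. 1 / ?q * xlogx ?q (p x))"
    using q p by (intro xlogx_jensen(1)) auto
  moreover have "xlogx ?q (1 / ?q) = - 1 / ?q"
    using q by (simp add: xlogx_def log_divide)
  ultimately have "- 1 / ?q \<le> (\<Sum>x\<in>UNIV. xlogx ?q (p x)) / ?q"
    by (simp only: sum_distrib_left[symmetric] p(2)) simp
  then show ?thesis using q by (simp add: redundancy_def field_simps)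
qed

lemma sym_capacity_bounds:
  fixes W :: "'x::finite \<Rightarrow> 'o pmf"
  assumes q: "1 < CARD('x)"
  shows "0 \<le> sym_capacity W" "sym_capacity W \<le> 1"
proof -
  have *: "0 \<le> redundancy (posterior W y) \<and> redundancy (posterior W y) \<le> 1" if "y \<in> set_pmf (out_pmf W)" for y
    using redundancy_nonneg[OF q, of "posterior W y"] redundancy_le_1[OF q, of "posterior W y"] sum_posterior[OF that]
    by (auto simp: posterior_nonneg posterior_le_1)
  show "0 \<le> sym_capacity W"
    unfolding sym_capacity_eq_expectation[OF q]
    by (rule integral_nonneg_AE) (use * in \<open>auto simp: AE_measure_pmf_iff\<close>)
  show "sym_capacity W \<le> 1"
    unfolding sym_capacity_eq_expectation[OF q]
    by (intro measure_pmf.integral_le_const bounded_integrable_pmf[where c = 1])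
       (use * in \<open>auto simp: AE_measure_pmf_iff\<close>)
qed

text \<open>Data processing: for each \<open>y\<close>, Gibbs' inequality compares the posterior
  given \<open>y\<close> with the posterior given \<open>f y\<close>.\<close>

lemma sym_capacity_map_pmf_le:
  fixes W :: "'x::finite \<Rightarrow> 'o pmf" and f :: "'o \<Rightarrow> 'p"
  assumes q: "1 < CARD('x)"
  shows "sym_capacity (\<lambda>x. map_pmf f (W x)) \<le> sym_capacity W"
proof -
  define V where "V = (\<lambda>x. map_pmf f (W x))"
  let ?q = "real CARD('x)"
  let ?P = "measure_pmf (out_pmf W)"
  \<comment> \<open>The information density of the degraded channel \<open>V\<close>; below it is
    evaluated at \<open>f y\<close> under the laws of \<open>W\<close>.\<close>
  define k where "k x z = log ?q (?q * posterior V z x)" for x z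
  have outV: "out_pmf V = map_pmf f (out_pmf W)"
    by (simp add: out_pmf_def V_def map_bind_pmf)
  have intk: "integrable ?P (\<lambda>y. posterior W y x * k x (f y))" for x
  proof -
    have "integrable (V x) (k x)"
      unfolding integrable_channel k_def by (rule integrable_posterior_log[OF q])
    then show ?thesis
      by (subst integrable_channel[symmetric]) (simp add: V_def)
  qed
  have "sym_capacity V = (\<Sum>x\<in>UNIV. measure_pmf.expectation (V x) (k x) / ?q)"
    unfolding sym_capacity_eq_sum[OF q] by (simp add: integral_channel[of V] k_def)
  also have "\<dots> = (\<Sum>x\<in>UNIV. measure_pmf.expectation (W x) (\<lambda>y. k x (f y)) / ?q)"
    by (simp add: V_def)
  also have "\<dots> = (\<Sum>x\<in>UNIV. measure_pmf.expectation (out_pmf W) (\<lambda>y. posterior W y x * k x (f y)))"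
    by (simp add: integral_channel[of W])
  also have "\<dots> = measure_pmf.expectation (out_pmf W) (\<lambda>y. \<Sum>x\<in>UNIV. posterior W y x * k x (f y))"
    by (simp add: intk)
  also have "\<dots> \<le> measure_pmf.expectation (out_pmf W)
      (\<lambda>y. \<Sum>x\<in>UNIV. posterior W y x * log ?q (?q * posterior W y x))"
  proof (intro integral_mono_AE Bochner_Integration.integrable_sum intk integrable_posterior_log[OF q])
    show "AE y in ?P. (\<Sum>x\<in>UNIV. posterior W y x * k x (f y))
        \<le> (\<Sum>x\<in>UNIV. posterior W y x * log ?q (?q * posterior W y x))"
      unfolding AE_measure_pmf_iff
    proof
      fix y assume y: "y \<in> set_pmf (out_pmf W)"
      then have fy: "f y \<in> set_pmf (out_pmf V)" by (simp add: outV)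
      \<comment> \<open>The tangent inequality at \<open>posterior V (f y) x\<close>. The linear
        correction cancels in the sum over \<open>x\<close>, since both posteriors sum to 1.\<close>
      have "posterior W y x * k x (f y) + (posterior W y x - posterior V (f y) x) / ln ?q
          \<le> posterior W y x * log ?q (?q * posterior W y x)" for x
      proof (cases "posterior W y x = 0")
        case True
        then show ?thesis using q posterior_nonneg[of V "f y" x] by simp
      next
        case False
        then have Wpos: "posterior W y x > 0" using posterior_nonneg[of W y x] by simp
        then have "y \<in> set_pmf (W x)" by (auto simp: posterior_def set_pmf_iff)
        then have "f y \<in> set_pmf (V x)" by (simp add: V_def)
        then have "posterior V (f y) x \<noteq> 0"
          using pmf_conv_posterior[of V x "f y"] by (auto simp: set_pmf_iff)
        then have Vpos: "posterior V (f y) x > 0" using posterior_nonneg[of V "f y" x] by simp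
        have "log ?q (?q * posterior V (f y) x) = 1 + log ?q (posterior V (f y) x)"
          "log ?q (?q * posterior W y x) = 1 + log ?q (posterior W y x)"
          using q Wpos Vpos by (simp_all add: log_mult)
        then show ?thesis
          using xlogx_tangent(1)[of ?q "posterior W y x" "posterior V (f y) x"] q Wpos Vpos
          by (simp add: k_def xlogx_def algebra_simps diff_divide_distrib)
      qed
      then have "(\<Sum>x\<in>UNIV. posterior W y x * k x (f y) + (posterior W y x - posterior V (f y) x) / ln ?q)
          \<le> (\<Sum>x\<in>UNIV. posterior W y x * log ?q (?q * posterior W y x))"
        by (rule sum_mono)
      then show "(\<Sum>x\<in>UNIV. posterior W y x * k x (f y))
          \<le> (\<Sum>x\<in>UNIV. posterior W y x * log ?q (?q * posterior W y x))"
        by (simp add: sum.distrib sum_subtractf sum_posterior[OF y] sum_posterior[OF fy] flip: sum_divide_distrib)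
    qed
  qed
  also have "\<dots> = sym_capacity W"
    by (simp add: sym_capacity_eq_sum[OF q] integrable_posterior_log[OF q])
  finally show ?thesis unfolding V_def .
qed

text \<open>The inverse of \<open>f\<close> undoes the processing, so data processing applies in
  both directions. This removes the constructor \<open>Node\<close> after a transform.\<close>

lemma sym_capacity_map_pmf_inj:
  fixes W :: "'x::finite \<Rightarrow> 'o pmf"
  assumes q: "1 < CARD('x)" and f: "inj f"
  shows "sym_capacity (\<lambda>x. map_pmf f (W x)) = sym_capacity W"
  using sym_capacity_map_pmf_le[OF q, of f W]
    sym_capacity_map_pmf_le[OF q, of "inv_into UNIV f" "\<lambda>x. map_pmf f (W x)"] f
  by (simp add: map_pmf_comp map_pmf_ident)

subsection \<open>The gain from a second observation\<close>

text \<open>In a field of prime order the characteristic equals the order, so the multiples of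
  \<open>d\<close> exhaust the field.\<close>

lemma periodic_prime_field:
  fixes p :: "'a::{field,finite} \<Rightarrow> 'b" and d :: 'a
  assumes "prime CARD('a)" "d \<noteq> 0" and per: "\<And>x. p (x + d) = p x"
  shows "p x = p y"
proof -
  have "CHAR('a) = CARD('a)"
    using CHAR_dvd_CARD[where 'a = 'a] assms(1) by (auto simp: prime_nat_iff)
  then have "inj_on (of_nat :: nat \<Rightarrow> 'a) {..<CARD('a)}"
    by (auto simp: inj_on_def of_nat_eq_iff_cong_CHAR cong_def)
  then have "card ((of_nat :: nat \<Rightarrow> 'a) ` {..<CARD('a)}) = CARD('a)"
    by (simp add: card_image)
  then have "(of_nat :: nat \<Rightarrow> 'a) ` {..<CARD('a)} = UNIV"
    by (intro card_subset_eq) auto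
  then obtain n where n: "(x - y) / d = of_nat n" by (metis UNIV_I imageE)
  have "p (y + of_nat m * d) = p y" for m
  proof (induction m)
    case (Suc m)
    have "y + of_nat (Suc m) * d = (y + of_nat m * d) + d" by (simp add: algebra_simps)
    then show ?case using Suc per by metis
  qed simp
  moreover have "x = y + of_nat n * d"
    using n assms(2) by (simp add: field_simps)
  ultimately show ?thesis by metis
qed

text \<open>Let X, X' be independent with laws \<open>p\<close>, \<open>r\<close>. Then
  \<open>r (c + u * b)\<close> is the probability of X' - b X = c given X = u. Summed over
  \<open>c\<close>, the first term is minus the entropy of X', as translations preserve entropy; the
  second is minus the entropy of X' - b X.\<close>

definition jensen_gain :: "'a::{field,finite} \<Rightarrow> ('a \<Rightarrow> real) \<Rightarrow> ('a \<Rightarrow> real) \<Rightarrow> real" where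
  "jensen_gain b p r = (\<Sum>c\<in>UNIV. (\<Sum>u\<in>UNIV. p u * xlogx CARD('a) (r (c + u * b)))
     - xlogx CARD('a) (\<Sum>u\<in>UNIV. p u * r (c + u * b)))"

lemma jensen_gain_nonneg:
  fixes p r :: "'a::{field,finite} \<Rightarrow> real"
  assumes "1 < CARD('a)" "\<And>x. 0 \<le> p x" "(\<Sum>x\<in>UNIV. p x) = 1" "\<And>x. 0 \<le> r x"
  shows "0 \<le> jensen_gain b p r"
  unfolding jensen_gain_def
  by (intro sum_nonneg) (use assms in \<open>auto intro!: xlogx_jensen(1)\<close>)

text \<open>If the gain vanishes and \<open>p\<close> has two points in its support, then \<open>r\<close> is periodic with their
  difference times \<open>b\<close> as period, hence uniform.\<close>

lemma jensen_gain_pos: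
  fixes p r :: "'a::{field,finite} \<Rightarrow> real"
  assumes pr: "prime CARD('a)" and b: "b \<noteq> 0"
    and p: "\<And>x. 0 \<le> p x" "(\<Sum>x\<in>UNIV. p x) = 1"
    and r: "\<And>x. 0 \<le> r x" "(\<Sum>x\<in>UNIV. r x) = 1"
    and Hp: "redundancy p < 1" and Hr: "0 < redundancy r"
  shows "0 < jensen_gain b p r"
proof -
  have q: "1 < CARD('a)" using pr prime_gt_1_nat by blast
  \<comment> \<open>Strictness in Jensen's inequality for a single \<open>c\<close> suffices, as the
    other summands are nonnegative.\<close>
  have ex: "\<exists>c u. 0 < p u \<and> r (c + u * b) \<noteq> (\<Sum>u\<in>UNIV. p u * r (c + u * b))"
  proof (rule ccontr)
    assume "\<not> ?thesis"
    then have const: "r (c + u * b) = (\<Sum>u\<in>UNIV. p u * r (c + u * b))" if "0 < p u" for c u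
      using that by blast
    have "\<exists>u. 0 < p u"
    proof (rule ccontr)
      assume "\<not> ?thesis"
      then have "p u \<le> 0" for u by (simp add: not_less)
      with p(1) have "p u = 0" for u by (simp add: antisym)
      with p(2) show False by simp
    qed
    then obtain u where u: "0 < p u" by blast
    show False
    proof (cases "\<exists>v. v \<noteq> u \<and> 0 < p v")
      case True
      then obtain v where v: "v \<noteq> u" "0 < p v" by blast
      have per: "r (x + (v - u) * b) = r x" for x
      proof -
        have "x + (v - u) * b = (x - u * b) + v * b" "x = (x - u * b) + u * b"
          by (simp_all add: algebra_simps)
        then show ?thesis using const[OF u, of "x - u * b"] const[OF v(2), of "x - u * b"] by metis
      qed
      have "(v - u) * b \<noteq> 0" using b v(1) by simp
      then have "r x = r y" for x y by (intro periodic_prime_field[where p = r, OF pr _ per])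
      then obtain t where t: "r = (\<lambda>_. t)" by (metis ext)
      then have "t = 1 / real CARD('a)" using r(2) by (simp add: field_simps)
      then have "redundancy r = 0"
        using q by (simp add: t redundancy_def xlogx_def log_divide)
      with Hr show False by simp
    next
      case False
      \<comment> \<open>With one support point, \<open>p\<close> is a point mass and has redundancy
        1, against \<open>Hp\<close>.\<close>
      then have "p v \<le> 0" if "v \<noteq> u" for v using that by (auto simp: not_less)
      with p(1) have z: "p v = 0" if "v \<noteq> u" for v using that by (simp add: antisym)
      then have "p u = 1" using p(2) sum.remove[of UNIV u p] by simp
      with z have "xlogx CARD('a) (p v) = 0" for v by (cases "v = u") auto
      then have "redundancy p = 1" by (simp add: redundancy_def)
      with Hp show False by simp
    qed
  qed
  then obtain c u where cu: "0 < p u" "r (c + u * b) \<noteq> (\<Sum>u\<in>UNIV. p u * r (c + u * b))" by blast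
  show ?thesis
    unfolding jensen_gain_def
  proof (rule sum_pos2[where i = c])
    show "0 < (\<Sum>u\<in>UNIV. p u * xlogx CARD('a) (r (c + u * b))) - xlogx CARD('a) (\<Sum>u\<in>UNIV. p u * r (c + u * b))"
      using xlogx_jensen(2)[of "CARD('a)" p "\<lambda>u. r (c + u * b)" u] q p r cu by simp
  qed (use q p r in \<open>auto intro!: xlogx_jensen(1)\<close>)
qed

section \<open>A uniform lower bound for the gain by compactness\<close>

lemma continuous_on_xlogx: "continuous_on {0..} (xlogx b)"
proof -
  have lim0: "((\<lambda>t::real. t * ln t) \<longlongrightarrow> 0) (at_right 0)"
  proof (rule Lim_null_comparison)
    have "norm (t * ln t) \<le> 2 * sqrt t" if "t > 0" "t < 1" for t :: real
    proof -
      have s: "0 < sqrt t" using that by simp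
      \<comment> \<open>Using \<open>1 / sqrt t\<close> in place of \<open>1 / t\<close> gives a
        bound on \<open>t * ln t\<close> that tends to 0 with \<open>t\<close>.\<close>
      have "ln (1 / sqrt t) \<le> 1 / sqrt t - 1" using s by (intro ln_le_minus_one) auto
      then have "- ln t \<le> 2 / sqrt t" using that by (simp add: ln_div ln_sqrt)
      then have "t * - ln t \<le> t * (2 / sqrt t)" using that by (intro mult_left_mono) auto
      also have "t * (2 / sqrt t) = 2 * sqrt t" using that by (simp add: real_div_sqrt flip: times_divide_eq_left)
      finally show ?thesis using that by (simp add: abs_mult abs_of_neg)
    qed
    then show "\<forall>\<^sub>F t in at_right (0::real). norm (t * ln t) \<le> 2 * sqrt t"
      by (subst eventually_at_right[of 0 1]) (auto intro!: exI[of _ 1])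
    show "((\<lambda>t. 2 * sqrt t) \<longlongrightarrow> 0) (at_right 0)"
      by (auto intro!: tendsto_eq_intros)
  qed
  have "continuous_on {0..} (\<lambda>t::real. t * ln t)"
    unfolding continuous_on_eq_continuous_within
  proof
    fix t :: real assume "t \<in> {0..}"
    show "continuous (at t within {0..}) (\<lambda>t. t * ln t)"
    proof (cases "t = 0")
      case True
      then show ?thesis using lim0 by (simp add: continuous_within at_within_Ici_at_right)
    next
      case False
      then show ?thesis by (intro continuous_intros) auto
    qed
  qed
  then have "continuous_on {0..} (\<lambda>t::real. t * ln t / ln b)"
    by (cases "ln b = 0") (auto intro: continuous_intros)
  then show ?thesis by (simp add: xlogx_def[abs_def] log_def)
qed

text \<open>The gain is continuous and positive on a compact set of pairs of distributions, so it
  attains a positive minimum there. The bound depends on \<open>b\<close> and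
  \<open>\<delta>\<close> only.\<close>

lemma jensen_gain_uniform:
  fixes b :: "'a::{field,finite}"
  assumes pr: "prime CARD('a)" and b: "b \<noteq> 0" and \<delta>: "0 < \<delta>"
  obtains \<epsilon> where "0 < \<epsilon>"
    "\<And>p r :: 'a \<Rightarrow> real. (\<And>x. 0 \<le> p x) \<Longrightarrow> (\<Sum>x\<in>UNIV. p x) = 1 \<Longrightarrow> (\<And>x. 0 \<le> r x) \<Longrightarrow> (\<Sum>x\<in>UNIV. r x) = 1 \<Longrightarrow>
       redundancy p \<le> 1 - \<delta> \<Longrightarrow> \<delta> \<le> redundancy r \<Longrightarrow> \<epsilon> \<le> jensen_gain b p r"
proof -
  \<comment> \<open>Distributions become Euclidean vectors so that closed bounded sets are compact.
    The qualified names avoid the matrix library's type \<open>vec\<close>.\<close>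
  let ?nth = "Finite_Cartesian_Product.vec_nth :: (real, 'a) Finite_Cartesian_Product.vec \<Rightarrow> 'a \<Rightarrow> real"
  define S where "S = {x. (\<forall>i. 0 \<le> ?nth x i) \<and> (\<Sum>i\<in>UNIV. ?nth x i) = 1}"
  have "S \<subseteq> cbox 0 1"
  proof
    fix x assume x: "x \<in> S"
    have "?nth x i \<le> (\<Sum>i\<in>UNIV. ?nth x i)" for i
      using x by (intro member_le_sum) (auto simp: S_def)
    then show "x \<in> cbox 0 1" using x by (auto simp: S_def mem_box_cart)
  qed
  moreover have "closed S"
    unfolding S_def by (intro closed_Collect_conj closed_Collect_all closed_Collect_le closed_Collect_eq continuous_intros)
  ultimately have cS: "compact S"
    using bounded_subset[OF bounded_cbox] by (auto simp: compact_eq_bounded_closed)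
  then have cSS: "compact (S \<times> S)" by (intro compact_Times)
  have xl: "continuous_on (S \<times> S) (\<lambda>z. xlogx CARD('a) (f z))"
    if "continuous_on (S \<times> S) f" "\<And>z. z \<in> S \<times> S \<Longrightarrow> 0 \<le> f z" for f
    by (rule continuous_on_compose2[OF continuous_on_xlogx that(1)]) (use that in auto)
  \<comment> \<open>Non-strict constraints keep \<open>K\<close> closed, and
    \<open>\<delta> > 0\<close> keeps it away from the pairs where the gain vanishes.\<close>
  define K where "K = (S \<times> S) \<inter> (\<lambda>z. redundancy (?nth (fst z))) -` {..1 - \<delta>}
      \<inter> ((S \<times> S) \<inter> (\<lambda>z. redundancy (?nth (snd z))) -` {\<delta>..})"
  have closed: "closed ((S \<times> S) \<inter> (\<lambda>z. redundancy (?nth (fst z))) -` {..1 - \<delta>})"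
    "closed ((S \<times> S) \<inter> (\<lambda>z. redundancy (?nth (snd z))) -` {\<delta>..})"
    unfolding redundancy_def
    by (intro continuous_closed_preimage compact_imp_closed[OF cSS] continuous_intros xl; auto simp: S_def)+
  have "compact ((S \<times> S) \<inter> K)"
    unfolding K_def by (intro compact_Int_closed cSS closed_Int closed)
  moreover have "(S \<times> S) \<inter> K = K" by (auto simp: K_def)
  ultimately have cK: "compact K" by simp
  have cont: "continuous_on K (\<lambda>z. jensen_gain b (?nth (fst z)) (?nth (snd z)))"
    unfolding jensen_gain_def
    by (rule continuous_on_subset[of "S \<times> S"], intro continuous_intros xl)
       (auto simp: S_def K_def intro!: sum_nonneg)
  have pos: "0 < jensen_gain b (?nth (fst z)) (?nth (snd z))" if "z \<in> K" for z
    using that \<delta> by (intro jensen_gain_pos pr b) (auto simp: K_def S_def)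
  obtain \<epsilon> where \<epsilon>: "0 < \<epsilon>" "\<And>z. z \<in> K \<Longrightarrow> \<epsilon> \<le> jensen_gain b (?nth (fst z)) (?nth (snd z))"
  proof (cases "K = {}")
    case True
    then show ?thesis using that[of 1] by auto
  next
    case False
    from continuous_attains_inf[OF cK False cont] pos show ?thesis using that by blast
  qed
  show ?thesis
  proof (rule that[OF \<epsilon>(1)])
    fix p r :: "'a \<Rightarrow> real"
    assume "\<And>x. 0 \<le> p x" "(\<Sum>x\<in>UNIV. p x) = 1" "\<And>x. 0 \<le> r x" "(\<Sum>x\<in>UNIV. r x) = 1"
      "redundancy p \<le> 1 - \<delta>" "\<delta> \<le> redundancy r"
    moreover have "?nth (Finite_Cartesian_Product.vec_lambda f) = f" for f by (intro ext) simp
    ultimately show "\<epsilon> \<le> jensen_gain b p r"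
      using \<epsilon>(2)[of "(Finite_Cartesian_Product.vec_lambda p, Finite_Cartesian_Product.vec_lambda r)"]
      by (auto simp: K_def S_def)
  qed
qed

section \<open>Capacity of the combined channel\<close>

definition combined_channel ::
  "'a::{field,finite} \<Rightarrow> ('a \<Rightarrow> 'o pmf) \<Rightarrow> ('a \<Rightarrow> 'p pmf) \<Rightarrow> 'a \<Rightarrow> ('o \<times> 'p \<times> 'a) pmf" where
  "combined_channel b W1 W2 u =
     out_pmf (\<lambda>c. map_pmf (\<lambda>(y1, y2). (y1, y2, c)) (pair_pmf (W1 u) (W2 (c + u * b))))"

lemma pmf_combined_channel:
  fixes W1 :: "'a::{field,finite} \<Rightarrow> 'o pmf" and W2 :: "'a \<Rightarrow> 'p pmf"
  shows "pmf (combined_channel b W1 W2 u) (y1, y2, c) = pmf (W1 u) y1 * pmf (W2 (c + u * b)) y2 / CARD('a)"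
proof -
  have "pmf (map_pmf (\<lambda>(y1, y2). (y1, y2, c')) (pair_pmf (W1 u) (W2 (c' + u * b)))) (y1, y2, c)
      = (if c' = c then pmf (W1 u) y1 * pmf (W2 (c + u * b)) y2 else 0)" for c'
  proof (cases "c' = c")
    case True
    have "inj (\<lambda>(y1::'o, y2::'p). (y1, y2, c))" by (auto simp: inj_def)
    from pmf_map_inj'[OF this, of _ "(y1, y2)"] True show ?thesis by (simp add: pmf_pair)
  next
    case False
    then show ?thesis by (auto intro!: pmf_map_outside)
  qed
  then show ?thesis by (simp add: combined_channel_def pmf_out_pmf)
qed

text \<open>The chain rule for entropy. Here \<open>s\<close> is the law of Z = X' - b X, and the
  entropy of X given Z is H(X) + H(X') - H(Z), because (X, Z) and (X, X') determine each
  other.\<close>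

lemma sum_redundancy_split:
  fixes p r :: "'a::{field,finite} \<Rightarrow> real" and b :: 'a
  assumes q: "1 < CARD('a)"
    and p: "\<And>x. 0 \<le> p x" "(\<Sum>x\<in>UNIV. p x) = 1"
    and r: "\<And>x. 0 \<le> r x" "(\<Sum>x\<in>UNIV. r x) = 1"
  defines "s c \<equiv> (\<Sum>u\<in>UNIV. p u * r (c + u * b))"
  shows "(\<Sum>c\<in>UNIV. s c * redundancy (\<lambda>u. p u * r (c + u * b) / s c)) = redundancy p + jensen_gain b p r"
proof -
  let ?X = "xlogx CARD('a)"
  \<comment> \<open>The third premise covers \<open>t = 0\<close>, where the quotient is 0 by
    convention and both sides vanish.\<close>
  have scale: "t * ?X (x / t) = ?X x - x * log CARD('a) t" if "0 \<le> x" "0 \<le> t" "t = 0 \<Longrightarrow> x = 0" for x t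
    using q that by (cases "t = 0 \<or> x = 0") (auto simp: xlogx_def log_divide algebra_simps)
  have sn: "0 \<le> s c" for c unfolding s_def by (intro sum_nonneg) (simp add: p r)
  have s0: "p u * r (c + u * b) = 0" if "s c = 0" for c u
    using that p(1) r(1) sum_nonneg_eq_0_iff[of UNIV "\<lambda>u. p u * r (c + u * b)"] by (auto simp: s_def)
  have shift: "(\<Sum>c\<in>UNIV. r (c + d)) = 1" for d
    using sum.reindex_bij_witness[of UNIV "\<lambda>c. c - d" "\<lambda>c. c + d" UNIV r "\<lambda>c. r (c + d)"] r(2) by simp
  have "s c * redundancy (\<lambda>u. p u * r (c + u * b) / s c)
      = s c + (\<Sum>u\<in>UNIV. p u * ?X (r (c + u * b))) + (\<Sum>u\<in>UNIV. r (c + u * b) * ?X (p u)) - ?X (s c)" for c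
  proof -
    have "s c * redundancy (\<lambda>u. p u * r (c + u * b) / s c)
        = s c + (\<Sum>u\<in>UNIV. s c * ?X (p u * r (c + u * b) / s c))"
      by (simp add: redundancy_def distrib_left sum_distrib_left)
    also have "(\<Sum>u\<in>UNIV. s c * ?X (p u * r (c + u * b) / s c))
        = (\<Sum>u\<in>UNIV. p u * ?X (r (c + u * b)) + r (c + u * b) * ?X (p u) - p u * r (c + u * b) * log CARD('a) (s c))"
      using q p r sn s0 by (intro sum.cong refl) (subst scale; auto simp: xlogx_mult)
    also have "\<dots> = (\<Sum>u\<in>UNIV. p u * ?X (r (c + u * b))) + (\<Sum>u\<in>UNIV. r (c + u * b) * ?X (p u))
        - s c * log CARD('a) (s c)"
      by (simp add: sum.distrib sum_subtractf s_def flip: sum_distrib_right)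
    finally show ?thesis by (simp add: xlogx_def)
  qed
  moreover have "(\<Sum>c\<in>UNIV. s c) = 1"
    unfolding s_def by (subst sum.swap) (simp add: shift p flip: sum_distrib_left)
  moreover have "(\<Sum>c\<in>UNIV. \<Sum>u\<in>UNIV. r (c + u * b) * ?X (p u)) = (\<Sum>u\<in>UNIV. ?X (p u))"
    by (subst sum.swap) (simp add: shift flip: sum_distrib_right)
  ultimately show ?thesis
    by (simp add: sum.distrib sum_subtractf redundancy_def jensen_gain_def s_def)
qed

text \<open>Stated on the unit cube and not only for distributions, so that it also covers the zero
  vector that \<open>posterior\<close> is off the support.\<close>

lemma redundancy_abs_le:
  fixes p :: "'x::finite \<Rightarrow> real"
  assumes q: "1 < CARD('x)" and p: "\<And>x. 0 \<le> p x" "\<And>x. p x \<le> 1"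
  shows "\<bar>redundancy p\<bar> \<le> 1 + CARD('x) / ln CARD('x)"
proof -
  have "(\<Sum>x\<in>(UNIV::'x set). - 1 / ln CARD('x)) \<le> (\<Sum>x\<in>UNIV. xlogx CARD('x) (p x))"
    by (intro sum_mono xlogx_lower) (use q p in auto)
  moreover have "(\<Sum>x\<in>UNIV. xlogx CARD('x) (p x)) \<le> 0"
    by (intro sum_nonpos xlogx_nonpos) (use q p in auto)
  moreover have "0 \<le> CARD('x) / ln CARD('x)" using q by simp
  ultimately show ?thesis by (auto simp: redundancy_def abs_le_iff)
qed

text \<open>Two channels side by side form one channel with a pair as input; a uniform pair has
  independent uniform components.\<close>

lemma out_pmf_pair:
  fixes W1 :: "'x::finite \<Rightarrow> 'o pmf" and W2 :: "'z::finite \<Rightarrow> 'p pmf"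
  shows "out_pmf (\<lambda>(u, x). pair_pmf (W1 u) (W2 x)) = pair_pmf (out_pmf W1) (out_pmf W2)"
proof (rule pmf_eqI)
  fix z :: "'o \<times> 'p"
  obtain y1 y2 where z: "z = (y1, y2)" by (cases z)
  show "pmf (out_pmf (\<lambda>(u, x). pair_pmf (W1 u) (W2 x))) z = pmf (pair_pmf (out_pmf W1) (out_pmf W2)) z"
    unfolding z pmf_pair pmf_out_pmf
    by (simp add: case_prod_beta' pmf_pair sum_product sum.cartesian_product flip: UNIV_Times_UNIV)
qed

lemma posterior_pair:
  fixes W1 :: "'x::finite \<Rightarrow> 'o pmf" and W2 :: "'z::finite \<Rightarrow> 'p pmf"
  shows "posterior (\<lambda>(u, x). pair_pmf (W1 u) (W2 x)) (y1, y2) (u, x) = posterior W1 y1 u * posterior W2 y2 x"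
  by (simp add: posterior_def case_prod_beta' pmf_pair sum_product sum.cartesian_product flip: UNIV_Times_UNIV)

text \<open>Given outputs \<open>y1\<close>, \<open>y2\<close>, the side information
  \<open>c\<close> acts as an observation of X' - b X for X, X' drawn from the two posteriors.
  Averaging \<open>sum_redundancy_split\<close> over the outputs gives the formula.\<close>

lemma sym_capacity_combined_channel:
  fixes W1 :: "'a::{field,finite} \<Rightarrow> 'o pmf" and W2 :: "'a \<Rightarrow> 'p pmf"
  assumes q: "1 < CARD('a)"
  shows "sym_capacity (combined_channel b W1 W2) = sym_capacity W1
    + measure_pmf.expectation (pair_pmf (out_pmf W1) (out_pmf W2))
        (\<lambda>(y1, y2). jensen_gain b (posterior W1 y1) (posterior W2 y2))"
    and "integrable (pair_pmf (out_pmf W1) (out_pmf W2)) (\<lambda>(y1, y2). jensen_gain b (posterior W1 y1) (posterior W2 y2))"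
proof -
  define V where "V = combined_channel b W1 W2"
  let ?q = "real CARD('a)" and ?P = "pair_pmf (out_pmf W1) (out_pmf W2)"
  define k where "k z = redundancy (posterior V z)" for z
  define C where "C = 1 + ?q / ln ?q"
  have k: "\<bar>k z\<bar> \<le> C" for z
    unfolding k_def C_def by (intro redundancy_abs_le q posterior_nonneg posterior_le_1)
  define h where "h u c = (\<lambda>(y1, y2). posterior W1 y1 u * posterior W2 y2 (c + u * b) * k (y1, y2, c))" for u c
  have hb: "\<bar>h u c z\<bar> \<le> C" for u c z
  proof -
    obtain y1 y2 where z: "z = (y1, y2)" by (cases z)
    have "\<bar>h u c z\<bar> = posterior W1 y1 u * posterior W2 y2 (c + u * b) * \<bar>k (y1, y2, c)\<bar>"
      by (simp add: h_def z abs_mult abs_of_nonneg[OF posterior_nonneg])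
    also have "\<dots> \<le> (1 * 1) * C"
      using k by (intro mult_mono posterior_le_1 mult_nonneg_nonneg posterior_nonneg) auto
    finally show ?thesis by simp
  qed
  have int: "integrable (measure_pmf ?P) (h u c)" for u c
    by (rule bounded_integrable_pmf[where c = C]) (rule hb)
  have redint: "integrable (measure_pmf ?P) (\<lambda>(y1, y2). redundancy (posterior W1 y1))"
    by (rule bounded_integrable_pmf[where c = C])
       (auto simp: C_def intro!: redundancy_abs_le q posterior_nonneg posterior_le_1)
  have pair: "measure_pmf.expectation (pair_pmf (W1 u) (W2 x)) f
      = ?q * ?q * measure_pmf.expectation ?P (\<lambda>(y1, y2). posterior W1 y1 u * posterior W2 y2 x * f (y1, y2))" for u x f
  proof -
    have "(\<lambda>z. posterior (\<lambda>(u, x). pair_pmf (W1 u) (W2 x)) z (u, x) * f z)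
        = (\<lambda>(y1, y2). posterior W1 y1 u * posterior W2 y2 x * f (y1, y2))"
      by (auto simp: fun_eq_iff posterior_pair)
    with integral_channel[of "\<lambda>(u, x). pair_pmf (W1 u) (W2 x)" "(u, x)" f]
    show ?thesis unfolding out_pmf_pair by simp
  qed
  \<comment> \<open>Of the two factors q in \<open>pair\<close>, averaging over \<open>c\<close>
    cancels one here; averaging over \<open>u\<close> cancels the other below.\<close>
  have "measure_pmf.expectation (V u) k
      = (\<Sum>c\<in>UNIV. ?q * measure_pmf.expectation ?P (h u c))" for u
    unfolding V_def combined_channel_def
    by (subst expectation_out_pmf[OF k])
       (simp add: pair h_def case_prod_beta' sum_divide_distrib)
  then have "measure_pmf.expectation (out_pmf V) k = (\<Sum>u\<in>UNIV. \<Sum>c\<in>UNIV. measure_pmf.expectation ?P (h u c))"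
    by (subst expectation_out_pmf[OF k]) (simp add: sum_divide_distrib)
  then have "sym_capacity V = (\<Sum>u\<in>UNIV. \<Sum>c\<in>UNIV. measure_pmf.expectation ?P (h u c))"
    by (simp add: sym_capacity_eq_expectation[OF q] k_def[abs_def])
  also have "\<dots> = measure_pmf.expectation ?P (\<lambda>z. \<Sum>u\<in>UNIV. \<Sum>c\<in>UNIV. h u c z)"
    by (simp add: int)
  finally have V: "sym_capacity V = measure_pmf.expectation ?P (\<lambda>z. \<Sum>u\<in>UNIV. \<Sum>c\<in>UNIV. h u c z)" .
  have *: "(\<Sum>u\<in>UNIV. \<Sum>c\<in>UNIV. h u c z)
      = (case z of (y1, y2) \<Rightarrow> redundancy (posterior W1 y1) + jensen_gain b (posterior W1 y1) (posterior W2 y2))"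
    if "z \<in> set_pmf ?P" for z
  proof -
    obtain y1 y2 where z: "z = (y1, y2)" by (cases z)
    with that have y: "y1 \<in> set_pmf (out_pmf W1)" "y2 \<in> set_pmf (out_pmf W2)" by auto
    define p where "p = posterior W1 y1"
    define r where "r = posterior W2 y2"
    define s where "s c = (\<Sum>u\<in>UNIV. p u * r (c + u * b))" for c
    have P: "pmf (out_pmf W1) y1 \<noteq> 0" "pmf (out_pmf W2) y2 \<noteq> 0" using y by (auto simp: set_pmf_iff)
    have eq: "pmf (V u) (y1, y2, c)
        = (?q * pmf (out_pmf W1) y1 * pmf (out_pmf W2) y2) * (p u * r (c + u * b))" for u c
      unfolding V_def pmf_combined_channel pmf_conv_posterior[of W1 _ y1] pmf_conv_posterior[of W2 _ y2] p_def r_def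
      by simp
    have posteriorV: "posterior V (y1, y2, c) = (\<lambda>u. p u * r (c + u * b) / s c)" for c
    proof
      fix u
      show "posterior V (y1, y2, c) u = p u * r (c + u * b) / s c"
        unfolding posterior_def[of V] eq sum_distrib_left[symmetric] s_def using P by simp
    qed
    have "(\<Sum>u\<in>UNIV. \<Sum>c\<in>UNIV. h u c z) = (\<Sum>c\<in>UNIV. s c * redundancy (\<lambda>u. p u * r (c + u * b) / s c))"
      by (subst sum.swap) (simp add: h_def z k_def posteriorV s_def sum_distrib_right p_def r_def)
    also have "\<dots> = redundancy p + jensen_gain b p r"
      unfolding s_def
      by (rule sum_redundancy_split[OF q]) (auto simp: p_def r_def posterior_nonneg sum_posterior y)
    finally show ?thesis by (simp add: z p_def r_def)
  qed
  \<comment> \<open>On the support the gain is this difference of two integrable functions, by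
    \<open>*\<close>.\<close>
  have "integrable (measure_pmf ?P)
      (\<lambda>z. (\<Sum>u\<in>UNIV. \<Sum>c\<in>UNIV. h u c z) - (case z of (y1, y2) \<Rightarrow> redundancy (posterior W1 y1)))"
    by (intro Bochner_Integration.integrable_diff Bochner_Integration.integrable_sum int redint)
  then show gint: "integrable (measure_pmf ?P) (\<lambda>(y1, y2). jensen_gain b (posterior W1 y1) (posterior W2 y2))"
    by (rule integrable_cong_AE_imp) (auto simp: AE_measure_pmf_iff * simp del: set_pair_pmf)
  have "measure_pmf.expectation ?P (\<lambda>z. \<Sum>u\<in>UNIV. \<Sum>c\<in>UNIV. h u c z)
      = measure_pmf.expectation ?P (\<lambda>z. (case z of (y1, y2) \<Rightarrow> redundancy (posterior W1 y1))
          + (case z of (y1, y2) \<Rightarrow> jensen_gain b (posterior W1 y1) (posterior W2 y2)))"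
    by (intro integral_cong_AE) (auto simp: AE_measure_pmf_iff * simp del: set_pair_pmf)
  also have "\<dots> = measure_pmf.expectation ?P (\<lambda>(y1, y2). redundancy (posterior W1 y1))
      + measure_pmf.expectation ?P (\<lambda>(y1, y2). jensen_gain b (posterior W1 y1) (posterior W2 y2))"
    by (rule Bochner_Integration.integral_add[OF redint gint])
  also have "measure_pmf.expectation ?P (\<lambda>(y1, y2). redundancy (posterior W1 y1))
      = measure_pmf.expectation (map_pmf fst ?P) (\<lambda>y1. redundancy (posterior W1 y1))"
    by (simp add: case_prod_beta')
  also have "\<dots> = sym_capacity W1"
    by (simp add: map_fst_pair_pmf sym_capacity_eq_expectation[OF q])
  finally show "sym_capacity (combined_channel b W1 W2) = sym_capacity W1
    + measure_pmf.expectation ?P (\<lambda>(y1, y2). jensen_gain b (posterior W1 y1) (posterior W2 y2))"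
    using V by (simp add: V_def)
qed

section \<open>Quantitative gain for channels of intermediate capacity\<close>

lemma integrable_indicator_pmf [simp]: "integrable (measure_pmf p) (indicat_real A)"
  by (rule bounded_integrable_pmf[where c = 1]) (simp add: indicator_def)

text \<open>A reverse Markov inequality: redundancy is at most 1, so its mean is at most the
  probability of \<open>?A\<close> plus \<open>\<delta> / 2\<close>.\<close>

lemma prob_redundancy_ge:
  fixes W :: "'x::finite \<Rightarrow> 'o pmf"
  assumes q: "1 < CARD('x)" and \<delta>: "0 < \<delta>" and I: "\<delta> \<le> sym_capacity W"
  shows "\<delta> / 2 \<le> measure_pmf.prob (out_pmf W) {y \<in> set_pmf (out_pmf W). \<delta> / 2 \<le> redundancy (posterior W y)}"
    (is "_ \<le> measure_pmf.prob _ ?A")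
proof -
  have "sym_capacity W \<le> measure_pmf.expectation (out_pmf W) (\<lambda>y. indicator ?A y + \<delta> / 2)"
    unfolding sym_capacity_eq_expectation[OF q]
  proof (rule integral_mono_AE)
    show "integrable (measure_pmf (out_pmf W)) (\<lambda>y. redundancy (posterior W y))"
      by (rule bounded_integrable_pmf) (rule redundancy_abs_le[OF q posterior_nonneg posterior_le_1])
    have "redundancy (posterior W y) \<le> 1" for y by (rule redundancy_le_1[OF q posterior_nonneg posterior_le_1])
    then show "AE y in measure_pmf (out_pmf W). redundancy (posterior W y) \<le> indicator ?A y + \<delta> / 2"
      using \<delta> by (auto simp: AE_measure_pmf_iff indicator_def add_increasing2)
  qed simp
  then show ?thesis using I by simp
qed

text \<open>The mirror image of \<open>prob_redundancy_ge\<close>, using that redundancy is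
  nonnegative on the support.\<close>

lemma prob_redundancy_le:
  fixes W :: "'x::finite \<Rightarrow> 'o pmf"
  assumes q: "1 < CARD('x)" and \<delta>: "0 < \<delta>" and I: "sym_capacity W \<le> 1 - \<delta>"
  shows "\<delta> / 2 \<le> measure_pmf.prob (out_pmf W) {y \<in> set_pmf (out_pmf W). redundancy (posterior W y) \<le> 1 - \<delta> / 2}"
    (is "_ \<le> measure_pmf.prob _ ?A")
proof -
  have "measure_pmf.expectation (out_pmf W) (\<lambda>y. 1 - \<delta> / 2 - indicator ?A y) \<le> sym_capacity W"
    unfolding sym_capacity_eq_expectation[OF q]
  proof (rule integral_mono_AE)
    show "integrable (measure_pmf (out_pmf W)) (\<lambda>y. redundancy (posterior W y))"
      by (rule bounded_integrable_pmf) (rule redundancy_abs_le[OF q posterior_nonneg posterior_le_1])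
    have "0 \<le> redundancy (posterior W y)" if "y \<in> set_pmf (out_pmf W)" for y
      by (rule redundancy_nonneg[OF q posterior_nonneg sum_posterior[OF that]])
    then show "AE y in measure_pmf (out_pmf W). 1 - \<delta> / 2 - indicator ?A y \<le> redundancy (posterior W y)"
      using \<delta> by (force simp: AE_measure_pmf_iff indicator_def)
  qed simp
  then show ?thesis using I by simp
qed

text \<open>The two outputs are independent, so both posteriors are favourable with probability at
  least \<open>(\<delta> / 2)\<^sup>2\<close>. The gain is then at least \<open>\<epsilon>\<close>,
  and it is nonnegative otherwise.\<close>

lemma sym_capacity_combined_channel_gain:
  fixes W1 :: "'a::{field,finite} \<Rightarrow> 'o pmf" and W2 :: "'a \<Rightarrow> 'p pmf"
  assumes q: "1 < CARD('a)" and \<delta>: "0 < \<delta>" and \<epsilon>: "0 < \<epsilon>"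
    and gain: "\<And>p r :: 'a \<Rightarrow> real. (\<And>x. 0 \<le> p x) \<Longrightarrow> (\<Sum>x\<in>UNIV. p x) = 1 \<Longrightarrow> (\<And>x. 0 \<le> r x) \<Longrightarrow> (\<Sum>x\<in>UNIV. r x) = 1 \<Longrightarrow>
       redundancy p \<le> 1 - \<delta> / 2 \<Longrightarrow> \<delta> / 2 \<le> redundancy r \<Longrightarrow> \<epsilon> \<le> jensen_gain b p r"
    and I: "sym_capacity W1 \<le> 1 - \<delta>" "\<delta> \<le> sym_capacity W2"
  shows "sym_capacity W1 + \<epsilon> * (\<delta> / 2)\<^sup>2 \<le> sym_capacity (combined_channel b W1 W2)"
proof -
  let ?P1 = "out_pmf W1" and ?P2 = "out_pmf W2"
  define A where "A = {y \<in> set_pmf ?P1. redundancy (posterior W1 y) \<le> 1 - \<delta> / 2}"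
  define B where "B = {y \<in> set_pmf ?P2. \<delta> / 2 \<le> redundancy (posterior W2 y)}"
  \<comment> \<open>The intersection with the supports makes both sets countable, as the product
    rule for probabilities requires.\<close>
  have cnt: "countable A" "countable B" by (auto simp: A_def B_def)
  have "(\<delta> / 2)\<^sup>2 \<le> measure_pmf.prob ?P1 A * measure_pmf.prob ?P2 B"
    unfolding power2_eq_square A_def B_def
    using prob_redundancy_le[OF q \<delta> I(1)] prob_redundancy_ge[OF q \<delta> I(2)] \<delta>
    by (intro mult_mono) auto
  also have "\<dots> = measure_pmf.prob (pair_pmf ?P1 ?P2) (A \<times> B)"
    by (rule measure_pmf_prob_product[OF cnt, symmetric])
  finally have "\<epsilon> * (\<delta> / 2)\<^sup>2 \<le> \<epsilon> * measure_pmf.prob (pair_pmf ?P1 ?P2) (A \<times> B)"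
    using \<epsilon> by (intro mult_left_mono) auto
  also have "\<dots> = measure_pmf.expectation (pair_pmf ?P1 ?P2) (\<lambda>z. \<epsilon> * indicator (A \<times> B) z)"
    by simp
  also have "\<dots> \<le> measure_pmf.expectation (pair_pmf ?P1 ?P2)
      (\<lambda>(y1, y2). jensen_gain b (posterior W1 y1) (posterior W2 y2))"
  proof (rule integral_mono_AE)
    have "\<epsilon> * indicator (A \<times> B) (y1, y2) \<le> jensen_gain b (posterior W1 y1) (posterior W2 y2)"
      if "y1 \<in> set_pmf ?P1" "y2 \<in> set_pmf ?P2" for y1 y2
    proof (cases "(y1, y2) \<in> A \<times> B")
      case True
      then show ?thesis
        using gain[OF posterior_nonneg sum_posterior posterior_nonneg sum_posterior] that by (auto simp: A_def B_def)
    next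
      case False
      then show ?thesis
        using jensen_gain_nonneg[OF q posterior_nonneg sum_posterior posterior_nonneg] that by auto
    qed
    then show "AE z in measure_pmf (pair_pmf ?P1 ?P2). \<epsilon> * indicator (A \<times> B) z
        \<le> (case z of (y1, y2) \<Rightarrow> jensen_gain b (posterior W1 y1) (posterior W2 y2))"
      by (auto simp: AE_measure_pmf_iff)
    show "integrable (measure_pmf (pair_pmf ?P1 ?P2)) (\<lambda>(y1, y2). jensen_gain b (posterior W1 y1) (posterior W2 y2))"
      by (rule sym_capacity_combined_channel(2)[OF q])
  qed simp
  finally show ?thesis by (simp add: sym_capacity_combined_channel(1)[OF q])
qed

subsection \<open>Split channels of triangular kernels\<close>

lemma pmf_of_set_lists:
  shows set_pmf_of_set_lists: "set_pmf (pmf_of_set {xs :: 'x::finite list. length xs = n}) = {xs. length xs = n}"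
    and integral_pmf_of_set_lists: "measure_pmf.expectation (pmf_of_set {xs :: 'x list. length xs = n}) f
      = (\<Sum>xs | length xs = n. f xs) / real CARD('x) ^ n"
proof -
  let ?S = "{xs :: 'x list. length xs = n}"
  have ne: "?S \<noteq> {}" and fin: "finite ?S"
    using finite_lists_length_eq[of "UNIV :: 'x set" n] Ex_list_of_length[of n] by auto
  have card: "card ?S = CARD('x) ^ n"
    using card_lists_length_eq[of "UNIV :: 'x set" n] by simp
  show "set_pmf (pmf_of_set ?S) = ?S" by (rule set_pmf_of_set[OF ne fin])
  show "measure_pmf.expectation (pmf_of_set ?S) f = (\<Sum>xs | length xs = n. f xs) / real CARD('x) ^ n"
    by (subst integral_pmf_of_set[OF ne fin]) (simp add: card)
qed

text \<open>A generative form: draw past and future inputs uniformly, transmit, and reveal the past.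
  Images of the split channel can then be computed by the monad laws.\<close>

lemma split_channel_eq_bind:
  fixes g :: "'x::finite list \<Rightarrow> 'x list" and W :: "'x \<Rightarrow> 'o pmf"
  assumes i: "i < l" and g: "\<And>xs. length xs = l \<Longrightarrow> length (g xs) = l"
  shows "split_channel l g W i u =
    bind_pmf (pmf_of_set {us. length us = i}) (\<lambda>us.
      bind_pmf (pmf_of_set {vs. length vs = l - 1 - i}) (\<lambda>vs.
        map_pmf (\<lambda>ys. (ys, us)) (power_pmf W (g (us @ [u] @ vs)))))" (is "_ = ?R")
proof (rule pmf_eqI)
  fix z :: "'o list \<times> 'x list"
  obtain ys ws where z: "z = (ys, ws)" by (cases z)
  let ?q = "real CARD('x)"
  let ?V = "{vs :: 'x list. length vs = l - 1 - i}" and ?U = "{us :: 'x list. length us = i}"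
  have map: "pmf (map_pmf (\<lambda>ys. (ys, us)) p) (ys, ws) = (if us = ws then pmf p ys else 0)"
    for us :: "'x list" and p :: "'o list pmf"
  proof (cases "us = ws")
    case True
    have "inj (\<lambda>ys :: 'o list. (ys, ws))" by (auto simp: inj_def)
    from pmf_map_inj'[OF this] True show ?thesis by simp
  qed (auto intro!: pmf_map_outside)
  have pow: "?q ^ i * ?q ^ (l - 1 - i) = ?q ^ (l - 1)" using i by (simp flip: power_add)
  have "pmf ?R z = (\<Sum>us\<in>?U. (\<Sum>vs\<in>?V. if us = ws then pmf (power_pmf W (g (us @ [u] @ vs))) ys else 0)
      / ?q ^ (l - 1 - i)) / ?q ^ i"
    unfolding z pmf_bind by (simp only: integral_pmf_of_set_lists map)
  also have "\<dots> = (\<Sum>us\<in>?U. if us = ws then (\<Sum>vs\<in>?V. pmf (power_pmf W (g (us @ [u] @ vs))) ys)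
      / ?q ^ (l - 1 - i) else 0) / ?q ^ i"
    by (intro arg_cong2[where f = "(/)"] sum.cong refl) simp
  also have "\<dots> = (if length ws = i then (\<Sum>vs\<in>?V. pmf (power_pmf W (g (ws @ [u] @ vs))) ys)
      / ?q ^ (l - 1 - i) else 0) / ?q ^ i"
    using finite_lists_length_eq[of "UNIV :: 'x set" i] by (simp add: sum.delta)
  also have "\<dots> = split_prob l g W i u z"
  proof (cases "length ws = i")
    case True
    then have "pmf (power_pmf W (g (ws @ [u] @ vs))) ys
        = (if length ys = l then power_prob l W ys (g (ws @ [u] @ vs)) else 0)" if "vs \<in> ?V" for vs
      using that i g[of "ws @ [u] @ vs"] by (simp add: pmf_power_pmf)
    then have "(\<Sum>vs\<in>?V. pmf (power_pmf W (g (ws @ [u] @ vs))) ys)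
        = (\<Sum>vs\<in>?V. if length ys = l then power_prob l W ys (g (ws @ [u] @ vs)) else 0)"
      by (rule sum.cong[OF refl])
    then show ?thesis
      using True pow by (simp add: z split_prob_def mult.commute)
  qed (simp add: z split_prob_def)
  finally show "pmf (split_channel l g W i u) z = pmf ?R z"
    by (simp add: pmf_split_channel[OF i g])
qed

lemma map_nth_power_pmf:
  "j < length xs \<Longrightarrow> map_pmf (\<lambda>ys. ys ! j) (power_pmf W xs) = W (xs ! j)"
proof (induction xs arbitrary: j)
  case (Cons x xs)
  show ?case
  proof (cases j)
    case 0
    then show ?thesis by (simp add: pmf.map_comp o_def case_prod_beta' map_fst_pair_pmf)
  next
    case (Suc i)
    then have "map_pmf (\<lambda>ys. ys ! j) (power_pmf W (x # xs))
        = map_pmf (\<lambda>ys. ys ! i) (map_pmf snd (pair_pmf (W x) (power_pmf W xs)))"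
      by (simp add: pmf.map_comp o_def case_prod_beta')
    with Cons Suc show ?thesis by (simp add: map_snd_pair_pmf)
  qed
qed simp

lemma map_nth_pair_power_pmf:
  "j < k \<Longrightarrow> k < length xs \<Longrightarrow>
    map_pmf (\<lambda>ys. (ys ! j, ys ! k)) (power_pmf W xs) = pair_pmf (W (xs ! j)) (W (xs ! k))"
proof (induction xs arbitrary: j k)
  case (Cons x xs)
  then obtain k' where k: "k = Suc k'" by (cases k) auto
  show ?case
  proof (cases j)
    case 0
    have "map_pmf (\<lambda>ys. (ys ! j, ys ! k)) (power_pmf W (x # xs))
        = map_pmf (apsnd (\<lambda>ys. ys ! k')) (pair_pmf (W x) (power_pmf W xs))"
      by (simp add: 0 k pmf.map_comp o_def case_prod_beta' apsnd_def map_prod_def)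
    also have "\<dots> = pair_pmf (W x) (W (xs ! k'))"
      using Cons.prems k by (simp add: map_nth_power_pmf flip: pair_map_pmf2)
    finally show ?thesis by (simp add: 0 k)
  next
    case (Suc i)
    then have "map_pmf (\<lambda>ys. (ys ! j, ys ! k)) (power_pmf W (x # xs))
        = map_pmf (\<lambda>ys. (ys ! i, ys ! k')) (map_pmf snd (pair_pmf (W x) (power_pmf W xs)))"
      by (simp add: k pmf.map_comp o_def case_prod_beta')
    with Cons Suc k show ?thesis by (simp add: map_snd_pair_pmf)
  qed
qed simp

text \<open>Adding \<open>d / a j\<close> to coordinate \<open>j\<close> permutes the tuples and
  shifts the linear form by \<open>d\<close>. Its law is therefore invariant under
  translation.\<close>

lemma map_linear_form_pmf_of_set:
  fixes a :: "nat \<Rightarrow> 'a::{field,finite}"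
  assumes j: "j < k" "a j \<noteq> 0"
  shows "map_pmf (\<lambda>us. \<Sum>i<k. us ! i * a i) (pmf_of_set {us. length us = k}) = pmf_of_set UNIV"
proof -
  let ?S = "{us :: 'a list. length us = k}"
  let ?c = "\<lambda>us :: 'a list. \<Sum>i<k. us ! i * a i"
  let ?M = "map_pmf ?c (pmf_of_set ?S)"
  have const: "pmf ?M d = pmf ?M 0" for d
  proof -
    let ?T = "\<lambda>us. us[j := us ! j + d / a j]"
    have "bij_betw ?T ?S ?S"
      by (rule bij_betw_byWitness[where f' = "\<lambda>us. us[j := us ! j - d / a j]"]) (use j in auto)
    then have T: "map_pmf ?T (pmf_of_set ?S) = pmf_of_set ?S"
      using finite_lists_length_eq[of "UNIV :: 'a set" k] Ex_list_of_length[of k]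
      by (intro map_pmf_of_set_bij_betw) auto
    have c: "?c (?T us) = ?c us + d" if "us \<in> ?S" for us
    proof -
      have "?c (?T us) = (\<Sum>i<k. us ! i * a i + (if i = j then d else 0))"
        using j that by (intro sum.cong refl) (auto simp: nth_list_update field_simps)
      then show ?thesis using j by (simp add: sum.distrib)
    qed
    have "?M = map_pmf ?c (map_pmf ?T (pmf_of_set ?S))" by (simp only: T)
    also have "\<dots> = map_pmf (\<lambda>us. ?c us + d) (pmf_of_set ?S)"
      unfolding pmf.map_comp
      by (intro map_pmf_cong refl) (use c in \<open>auto simp: set_pmf_of_set_lists\<close>)
    also have "\<dots> = map_pmf (\<lambda>x. x + d) ?M" by (simp add: pmf.map_comp o_def)
    finally have "pmf ?M (0 + d) = pmf (map_pmf (\<lambda>x. x + d) ?M) (0 + d)" by simp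
    also have "\<dots> = pmf ?M 0" by (rule pmf_map_inj') (auto simp: inj_def)
    finally show ?thesis by simp
  qed
  have "(\<Sum>d\<in>UNIV. pmf ?M d) = 1" by (rule sum_pmf_eq_1) auto
  moreover obtain t where t: "\<And>d. pmf ?M d = t" using const by blast
  ultimately have "t = 1 / real CARD('a)" by (simp add: field_simps)
  then show ?thesis by (intro pmf_eqI) (simp add: t)
qed

lemma length_linear_kernel [simp]: "length (linear_kernel G u) = dim_col G"
  by (simp add: linear_kernel_def)

text \<open>Column \<open>j\<close> vanishes below row \<open>k\<close>, so the unknown future
  inputs \<open>vs\<close> do not reach position \<open>j\<close>.\<close>

lemma linear_kernel_nth:
  assumes G: "G \<in> carrier_mat l l" and j: "j < l" and k: "k < l" "length us = k"
    and z: "\<And>i. k < i \<Longrightarrow> i < l \<Longrightarrow> G $$ (i, j) = 0"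
  shows "linear_kernel G (us @ [u] @ vs) ! j = (\<Sum>i<k. us ! i * G $$ (i, j)) + u * G $$ (k, j)"
proof -
  let ?w = "us @ [u] @ vs"
  have "linear_kernel G ?w ! j = (\<Sum>i<l. ?w ! i * G $$ (i, j))"
    using G j by (simp add: linear_kernel_def)
  also have "\<dots> = (\<Sum>i<Suc k. ?w ! i * G $$ (i, j))"
    using k z by (intro sum.mono_neutral_right) auto
  also have "\<dots> = (\<Sum>i<k. us ! i * G $$ (i, j)) + u * G $$ (k, j)"
    using k by (simp add: nth_append)
  finally show ?thesis .
qed

text \<open>The split channel of a row \<open>k\<close> with an off-diagonal entry in column \<open>j\<close> is at least as good as the
  channel that observes only the outputs at positions \<open>j\<close> and \<open>k\<close> and the contribution of the known
  inputs to position \<open>j\<close>, which is uniform since \<open>G\<^sub>j\<^sub>j \<noteq> 0\<close>.\<close>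

lemma sym_capacity_combined_le_split_channel:
  fixes W :: "'a::{field,finite} \<Rightarrow> 'o pmf"
  assumes q: "1 < CARD('a)" and G: "G \<in> carrier_mat l l" and k: "k < l" and j: "j < k"
    and diag: "G $$ (j, j) \<noteq> 0"
    and colk: "\<And>i. i < l \<Longrightarrow> i \<noteq> k \<Longrightarrow> G $$ (i, k) = 0"
    and colj: "\<And>i. k < i \<Longrightarrow> i < l \<Longrightarrow> G $$ (i, j) = 0"
  shows "sym_capacity (combined_channel (G $$ (k, j)) (\<lambda>u. W (u * G $$ (k, k))) W)
    \<le> sym_capacity (split_channel l (linear_kernel G) W k)"
proof -
  let ?c = "\<lambda>us :: 'a list. \<Sum>i<k. us ! i * G $$ (i, j)"
  let ?U = "pmf_of_set {us :: 'a list. length us = k}"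
  let ?f = "\<lambda>(ys, us). (ys ! k :: 'o, ys ! j :: 'o, ?c us)"
  define F where "F u c = map_pmf (\<lambda>(y1, y2). (y1, y2, c)) (pair_pmf (W (u * G $$ (k, k))) (W (c + u * G $$ (k, j))))"
    for u c
  have "map_pmf ?f (split_channel l (linear_kernel G) W k u)
      = combined_channel (G $$ (k, j)) (\<lambda>u. W (u * G $$ (k, k))) W u" for u
  proof -
    have inner: "map_pmf (\<lambda>ys. (ys ! k, ys ! j, ?c us)) (power_pmf W (linear_kernel G (us @ [u] @ vs))) = F u (?c us)"
      if us: "length us = k" for us vs
    proof -
      let ?x = "linear_kernel G (us @ [u] @ vs)"
      \<comment> \<open>Column \<open>k\<close> has only its diagonal entry, so the past inputs
        contribute nothing here.\<close>
      have xk: "?x ! k = u * G $$ (k, k)"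
        using linear_kernel_nth[OF G k k us, of u vs] colk k by simp
      have xj: "?x ! j = ?c us + u * G $$ (k, j)"
        using linear_kernel_nth[OF G _ k us, of j u vs] colj j k by simp
      have "map_pmf (\<lambda>ys. (ys ! k, ys ! j, ?c us)) (power_pmf W ?x)
          = map_pmf (\<lambda>(y2, y1). (y1, y2, ?c us)) (map_pmf (\<lambda>ys. (ys ! j, ys ! k)) (power_pmf W ?x))"
        by (simp add: pmf.map_comp o_def)
      also have "\<dots> = map_pmf (\<lambda>(y2, y1). (y1, y2, ?c us)) (pair_pmf (W (?x ! j)) (W (?x ! k)))"
        using G j k by (subst map_nth_pair_power_pmf) auto
      also have "\<dots> = F u (?c us)"
        unfolding xk xj F_def
        by (subst (2) pair_commute_pmf) (simp add: pmf.map_comp o_def case_prod_beta')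
      finally show ?thesis .
    qed
    have "map_pmf ?f (split_channel l (linear_kernel G) W k u)
        = bind_pmf ?U (\<lambda>us. bind_pmf (pmf_of_set {vs. length vs = l - 1 - k}) (\<lambda>vs.
            map_pmf (\<lambda>ys. (ys ! k, ys ! j, ?c us)) (power_pmf W (linear_kernel G (us @ [u] @ vs)))))"
      using G by (subst split_channel_eq_bind[OF k]) (simp_all add: map_bind_pmf pmf.map_comp o_def)
    \<comment> \<open>By \<open>inner\<close> the observed law is the same for all futures
      \<open>vs\<close>, so averaging over them collapses.\<close>
    also have "\<dots> = bind_pmf ?U (\<lambda>us. F u (?c us))"
      by (intro bind_pmf_cong refl) (simp add: set_pmf_of_set_lists inner del: append.simps)
    also have "\<dots> = bind_pmf (map_pmf ?c ?U) (F u)"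
      by (simp add: bind_map_pmf)
    also have "map_pmf ?c ?U = pmf_of_set UNIV"
      using j diag by (rule map_linear_form_pmf_of_set)
    finally show ?thesis by (simp add: combined_channel_def out_pmf_def F_def)
  qed
  then show ?thesis
    using sym_capacity_map_pmf_le[OF q, of ?f "split_channel l (linear_kernel G) W k"] by simp
qed

section \<open>Gain along the iteration\<close>

text \<open>Inputs are weighted uniformly, so relabelling them changes nothing. Applied to
  multiplication by the diagonal entry in row \<open>k\<close>.\<close>

lemma sym_capacity_bij:
  fixes W :: "'x::finite \<Rightarrow> 'o pmf" and \<pi> :: "'x \<Rightarrow> 'x"
  assumes "bij \<pi>"
  shows "sym_capacity (\<lambda>x. W (\<pi> x)) = sym_capacity W"
  unfolding sym_capacity_def
  by (simp only: sum.reindex_bij_betw[OF assms, of "\<lambda>x. pmf (W x) y" for y])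
     (rule sum.reindex_bij_betw[OF assms])

lemma iterated_channel_snoc:
  "iterated_channel l g W (bs @ [b]) =
     (\<lambda>u. map_pmf (\<lambda>(ys, us). Node ys us) (split_channel l g (iterated_channel l g W bs) b u))"
  by (simp add: iterated_channel_def)

text \<open>The constant is obtained before \<open>W\<close> and \<open>bs\<close> are fixed, so one
  \<open>\<eta>\<close> serves at every depth of the iteration.\<close>

lemma sym_capacity_iterated_gain:
  fixes G :: "'a::{field,finite} mat"
  assumes pr: "prime CARD('a)" and G: "G \<in> carrier_mat l l" and k: "k < l" and j: "j < k"
    and diag: "G $$ (j, j) \<noteq> 0" "G $$ (k, k) \<noteq> 0" and offdiag: "G $$ (k, j) \<noteq> 0"
    and colk: "\<And>i. i < l \<Longrightarrow> i \<noteq> k \<Longrightarrow> G $$ (i, k) = 0"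
    and colj: "\<And>i. k < i \<Longrightarrow> i < l \<Longrightarrow> G $$ (i, j) = 0"
    and \<delta>: "0 < \<delta>"
  obtains \<eta> where "0 < \<eta>"
    "\<And>(W :: 'a \<Rightarrow> 'y pmf) bs. \<delta> \<le> sym_capacity (iterated_channel l (linear_kernel G) W bs) \<Longrightarrow>
       sym_capacity (iterated_channel l (linear_kernel G) W bs) \<le> 1 - \<delta> \<Longrightarrow>
       sym_capacity (iterated_channel l (linear_kernel G) W bs) + \<eta>
         \<le> sym_capacity (iterated_channel l (linear_kernel G) W (bs @ [k]))"
proof -
  have q: "1 < CARD('a)" using pr prime_gt_1_nat by blast
  \<comment> \<open>Halved because the probability bounds locate posteriors only at distance
    \<open>\<delta> / 2\<close> from the extremes.\<close>
  from \<delta> have "0 < \<delta> / 2" by simp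
  from jensen_gain_uniform[OF pr offdiag this] obtain \<epsilon> where \<epsilon>: "0 < \<epsilon>"
    and gain: "\<And>p r :: 'a \<Rightarrow> real. (\<And>x. 0 \<le> p x) \<Longrightarrow> (\<Sum>x\<in>UNIV. p x) = 1 \<Longrightarrow> (\<And>x. 0 \<le> r x) \<Longrightarrow> (\<Sum>x\<in>UNIV. r x) = 1 \<Longrightarrow>
       redundancy p \<le> 1 - \<delta> / 2 \<Longrightarrow> \<delta> / 2 \<le> redundancy r \<Longrightarrow> \<epsilon> \<le> jensen_gain (G $$ (k, j)) p r"
    by blast
  show ?thesis
  proof (rule that)
    show "0 < \<epsilon> * (\<delta> / 2)\<^sup>2" using \<epsilon> \<delta> by simp
    fix W :: "'a \<Rightarrow> 'y pmf" and bs
    define V where "V = iterated_channel l (linear_kernel G) W bs"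
    assume I: "\<delta> \<le> sym_capacity (iterated_channel l (linear_kernel G) W bs)"
      "sym_capacity (iterated_channel l (linear_kernel G) W bs) \<le> 1 - \<delta>"
    have "bij (\<lambda>u. u * G $$ (k, k))"
      by (rule bij_betw_byWitness[where f' = "\<lambda>u. u / G $$ (k, k)"]) (use diag in auto)
    then have scale: "sym_capacity (\<lambda>u. V (u * G $$ (k, k))) = sym_capacity V"
      by (rule sym_capacity_bij)
    have "sym_capacity V + \<epsilon> * (\<delta> / 2)\<^sup>2
        \<le> sym_capacity (combined_channel (G $$ (k, j)) (\<lambda>u. V (u * G $$ (k, k))) V)"
      unfolding scale[symmetric]
    proof (rule sym_capacity_combined_channel_gain[OF q \<delta> \<epsilon>])
      show "sym_capacity (\<lambda>u. V (u * G $$ (k, k))) \<le> 1 - \<delta>" "\<delta> \<le> sym_capacity V"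
        unfolding scale using I by (simp_all add: V_def)
    qed (fact gain)
    also have "\<dots> \<le> sym_capacity (split_channel l (linear_kernel G) V k)"
      by (rule sym_capacity_combined_le_split_channel[OF q G k j diag(1) colk colj])
    also have "\<dots> = sym_capacity (iterated_channel l (linear_kernel G) W (bs @ [k]))"
      unfolding iterated_channel_snoc V_def[symmetric]
      by (rule sym_capacity_map_pmf_inj[OF q, symmetric]) (auto simp: inj_def)
    finally show "sym_capacity (iterated_channel l (linear_kernel G) W bs) + \<epsilon> * (\<delta> / 2)\<^sup>2
        \<le> sym_capacity (iterated_channel l (linear_kernel G) W (bs @ [k]))"
      by (simp add: V_def)
  qed
qed

subsection \<open>Polarization\<close>

text \<open>Avoiding \<open>k\<close> at \<open>t + 1\<close> consecutive times has probability
  \<open>r ^ Suc t\<close> with \<open>r < 1\<close>. Hence avoiding it forever from any given time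
  is a null event.\<close>

lemma (in prob_space) AE_indep_infinitely_often:
  fixes B :: "nat \<Rightarrow> 'a \<Rightarrow> nat"
  assumes ind: "indep_vars (\<lambda>_. count_space UNIV) B {1..}"
    and d: "\<And>n. n \<ge> 1 \<Longrightarrow> distr M (count_space UNIV) (B n) = measure_pmf (pmf_of_set {..<l})"
    and k: "k < l"
  shows "AE \<omega> in M. \<forall>N\<ge>1. \<exists>n\<ge>N. B n \<omega> = k"
proof -
  define r where "r = measure_pmf.prob (pmf_of_set {..<l}) (- {k})"
  have r1: "0 \<le> r" "r < 1"
  proof -
    have "r = 1 - measure_pmf.prob (pmf_of_set {..<l}) {k}"
      unfolding r_def using measure_pmf.prob_compl[of "{k}" "pmf_of_set {..<l}"] by (simp add: Compl_eq_Diff_UNIV)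
    moreover have "{..<l} \<noteq> {}" using k by auto
    ultimately show "r < 1" using k by (simp add: measure_pmf_single)
  qed (simp add: r_def)
  have meas: "B n \<in> measurable M (count_space UNIV)" if "n \<ge> 1" for n
    using ind that by (auto simp: indep_vars_def)
  have ev: "B n -` (- {k}) \<inter> space M \<in> events" if "n \<ge> 1" for n
    using measurable_sets[OF meas[OF that], of "- {k}"] by simp
  have pr: "prob (B n -` (- {k}) \<inter> space M) = r" if "n \<ge> 1" for n
    using measure_distr[OF meas[OF that], of "- {k}"] d[OF that] by (simp add: r_def)
  have "AE \<omega> in M. \<exists>n\<ge>N. B n \<omega> = k" if N: "N \<ge> 1" for N
  proof -
    define F where "F = (\<Inter>n\<in>{N..}. B n -` (- {k}) \<inter> space M)"
    have F: "F \<in> events"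
      unfolding F_def using N by (intro sets.countable_INT') (auto intro!: ev)
    have "prob F \<le> r ^ Suc t" for t
    proof -
      let ?J = "{N..N + t}"
      have "prob (\<Inter>n\<in>?J. B n -` (- {k}) \<inter> space M) = (\<Prod>n\<in>?J. prob (B n -` (- {k}) \<inter> space M))"
        using N by (intro indep_varsD[OF ind]) auto
      also have "\<dots> = r ^ Suc t" using N by (simp add: pr)
      finally have "prob (\<Inter>n\<in>?J. B n -` (- {k}) \<inter> space M) = r ^ Suc t" .
      moreover have "prob F \<le> prob (\<Inter>n\<in>?J. B n -` (- {k}) \<inter> space M)"
        unfolding F_def using N by (intro finite_measure_mono sets.finite_INT) (auto intro!: ev)
      ultimately show ?thesis by simp
    qed
    moreover have "(\<lambda>t. r ^ Suc t) \<longlonglongrightarrow> 0"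
      using r1 by (intro LIMSEQ_Suc LIMSEQ_power_zero) simp
    ultimately have "prob F \<le> 0" by (intro LIMSEQ_le_const[of _ 0]) auto
    then have "prob F = 0" by (simp add: measure_le_0_iff)
    then have "AE \<omega> in M. \<omega> \<notin> F" using F by (simp add: prob_eq_0)
    then show ?thesis by (rule AE_mp) (intro AE_I2 impI, auto simp: F_def)
  qed
  then have "AE \<omega> in M. \<forall>N. N \<ge> 1 \<longrightarrow> (\<exists>n\<ge>N. B n \<omega> = k)"
    unfolding AE_all_countable by (auto intro: AE_I2)
  then show ?thesis by simp
qed

text \<open>Full rank makes the determinant nonzero, and for a triangular matrix it is the product
  of the diagonal entries.\<close>

lemma lower_triangular_full_rank_diag:
  fixes G :: "'a::field mat"
  assumes G: "G \<in> carrier_mat l l" and rank: "vec_space.rank l G = l"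
    and tri: "lower_triangular G" and i: "i < l"
  shows "G $$ (i, i) \<noteq> 0"
proof -
  have "det G \<noteq> 0" using vec_space.det_rank_iff[OF G] rank by simp
  moreover have "det G = prod_list (diag_mat G)"
    using G tri by (intro det_lower_triangular[of l]) (auto simp: lower_triangular_def)
  ultimately have "0 \<notin> set (diag_mat G)" by (simp add: prod_list_zero_iff)
  then show ?thesis using G i by (auto simp: diag_mat_def)
qed

theorem theorem5p12:
  fixes W :: "'a::{field,finite} \<Rightarrow> 'y::countable pmf"
    and G :: "'a mat"
    and l :: nat
    and M :: "'w measure"
    and B :: "nat \<Rightarrow> 'w \<Rightarrow> nat"
    and I_inf :: "'w \<Rightarrow> real"
  assumes "prime CARD('a)"
    and "G \<in> carrier_mat l l"
    and "vec_space.rank l G = l"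
    and "lower_triangular G"
    and "\<not> diagonal_mat G"
    and "prob_space M"
    and "prob_space.indep_vars M (\<lambda>_. count_space UNIV) B {1..}"
    and "\<And>n. n \<ge> 1 \<Longrightarrow> distr M (count_space UNIV) (B n) = measure_pmf (pmf_of_set {..<l})"
    and "I_inf \<in> borel_measurable M"
    and "AE \<omega> in M. (\<lambda>n. sym_capacity
           (iterated_channel l (linear_kernel G) W (map (\<lambda>k. B k \<omega>) [1..<Suc n])))
         \<longlonglongrightarrow> I_inf \<omega>"
  shows "measure M {\<omega> \<in> space M. I_inf \<omega> \<in> {0, 1}} = 1"
proof -
  interpret prob_space M by fact
  note G = assms(2) and tri = assms(4)
  have q: "1 < CARD('a)" using assms(1) prime_gt_1_nat by blast
  have diag: "G $$ (i, i) \<noteq> 0" if "i < l" for i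
    using lower_triangular_full_rank_diag[OF G assms(3) tri that] .
  have upper: "G $$ (i, j) = 0" if "i < j" "j < l" for i j
    using tri G that by (auto simp: lower_triangular_def)
  \<comment> \<open>The last row with an off-diagonal entry is chosen: all rows below it are
    diagonal, which clears columns \<open>j\<close> and \<open>k\<close> below row
    \<open>k\<close>.\<close>
  define S where "S = {i. i < l \<and> (\<exists>j<i. G $$ (i, j) \<noteq> 0)}"
  define k where "k = Max S"
  have "finite S" by (simp add: S_def)
  moreover have "S \<noteq> {}"
  proof -
    obtain i j where "i < l" "j < l" "i \<noteq> j" "G $$ (i, j) \<noteq> 0"
      using assms(5) G by (auto simp: diagonal_mat_def)
    then show ?thesis using upper[of i j] by (auto simp: S_def neq_iff)
  qed
  ultimately have "k \<in> S" and max: "\<And>i. i \<in> S \<Longrightarrow> i \<le> k" by (auto simp: k_def)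
  then obtain j where k: "k < l" and j: "j < k" and offdiag: "G $$ (k, j) \<noteq> 0"
    by (auto simp: S_def)
  have below: "G $$ (i, j') = 0" if "k < i" "i < l" "j' < i" for i j'
    using max[of i] that by (auto simp: S_def)
  have colk: "G $$ (i, k) = 0" if "i < l" "i \<noteq> k" for i
    using that k upper[of i k] below[of i k] by (cases "i < k") auto
  have colj: "G $$ (i, j) = 0" if "k < i" "i < l" for i
    using that j below[of i j] by auto
  let ?V = "iterated_channel l (linear_kernel G) W"
  have io: "AE \<omega> in M. \<forall>N\<ge>1. \<exists>n\<ge>N. B n \<omega> = k"
    using assms(7,8) k by (rule AE_indep_infinitely_often)
  have "AE \<omega> in M. I_inf \<omega> \<in> {0, 1}"
    using assms(10) io
  proof eventually_elim
    case (elim \<omega>)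
    define bs where "bs n = map (\<lambda>k. B k \<omega>) [1..<Suc n]" for n
    define I where "I n = sym_capacity (?V (bs n))" for n
    have lim: "I \<longlonglongrightarrow> I_inf \<omega>" using elim(1) by (simp only: I_def[abs_def] bs_def)
    have bounds: "0 \<le> I_inf \<omega>" "I_inf \<omega> \<le> 1"
      by (rule LIMSEQ_le_const[OF lim] LIMSEQ_le_const2[OF lim]; simp add: I_def sym_capacity_bounds[OF q])+
    show ?case
    proof (rule ccontr)
      assume "\<not> ?case"
      with bounds have I01: "0 < I_inf \<omega>" "I_inf \<omega> < 1" by auto
      \<comment> \<open>Half the distance from the limit to {0, 1}, so that eventually the
        capacities stay strictly between \<open>\<delta>\<close> and
        \<open>1 - \<delta>\<close>.\<close>
      define \<delta> where "\<delta> = min (I_inf \<omega>) (1 - I_inf \<omega>) / 2"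
      have \<delta>: "0 < \<delta>" "\<delta> < I_inf \<omega>" "I_inf \<omega> < 1 - \<delta>" using I01 by (auto simp: \<delta>_def min_def field_simps)
      obtain \<eta> where \<eta>: "0 < \<eta>" and step:
        "\<And>(W :: 'a \<Rightarrow> 'y pmf) bs. \<delta> \<le> sym_capacity (iterated_channel l (linear_kernel G) W bs) \<Longrightarrow>
           sym_capacity (iterated_channel l (linear_kernel G) W bs) \<le> 1 - \<delta> \<Longrightarrow>
           sym_capacity (iterated_channel l (linear_kernel G) W bs) + \<eta>
             \<le> sym_capacity (iterated_channel l (linear_kernel G) W (bs @ [k]))"
      proof (rule sym_capacity_iterated_gain[where 'y = 'y, OF assms(1) G k j _ _ offdiag _ _ \<delta>(1)])
        show "G $$ (j, j) \<noteq> 0" "G $$ (k, k) \<noteq> 0" using diag j k by auto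
        show "G $$ (i, k) = 0" if "i < l" "i \<noteq> k" for i using that by (rule colk)
        show "G $$ (i, j) = 0" if "k < i" "i < l" for i using that by (rule colj)
      qed blast
      have "\<forall>\<^sub>F n in sequentially. \<delta> < I n \<and> I n < 1 - \<delta> \<and> I_inf \<omega> - \<eta> / 2 < I n \<and> I n < I_inf \<omega> + \<eta> / 2"
        using \<delta> \<eta> by (intro eventually_conj order_tendstoD[OF lim]) auto
      \<comment> \<open>From \<open>N\<close> on all capacities lie in an open interval of length
        \<open>\<eta>\<close>, which leaves no room for an increase by
        \<open>\<eta>\<close>.\<close>
      then obtain N where N: "\<And>n. n \<ge> N \<Longrightarrow> \<delta> < I n \<and> I n < 1 - \<delta> \<and> I_inf \<omega> - \<eta> / 2 < I n \<and> I n < I_inf \<omega> + \<eta> / 2"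
        by (auto simp: eventually_sequentially)
      \<comment> \<open>\<open>Suc N\<close> and not \<open>N\<close>, so that the capacity before
        the transform with index \<open>B n \<omega>\<close> also lies in that interval.\<close>
      obtain n where n: "n \<ge> Suc N" "B n \<omega> = k" using elim(2) by auto
      then obtain m where m: "n = Suc m" "m \<ge> N" by (cases n) auto
      have "bs (Suc m) = bs m @ [k]" using n m by (simp add: bs_def)
      with step[of W "bs m"] N[OF m(2)] have "I m + \<eta> \<le> I (Suc m)" by (simp add: I_def)
      with N[of m] N[of "Suc m"] m(2) show False by auto
    qed
  qed
  moreover have "{\<omega> \<in> space M. I_inf \<omega> \<in> {0, 1}} \<in> events"
    using assms(9) by measurable
  ultimately show ?thesis by (subst prob_Collect_eq_1) auto
qed

end
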